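(* Let $1\le p\le\infty$. Let $A$ and $B$ be non-empty, bounded, open sets in $\mathbb{R}^d$, with $r=\operatorname{diam}(A\cup B)$. Let $F:\mathbb{R}^d\to\mathbb{R}$ be in $L^p$ and supported on $A$, let $\epsilon>0$, let $\Phi:B\to A$ be an $\epsilon$-deformation, and define $F_\Phi(x)=F(\Phi(x))\,|\det(\nabla\Phi(x))|$ for $x\in B$ and $F_\Phi(x)=0$ elsewhere. Then for any unit vector $u\in\mathbb{S}^{d-1}$, $$\|\mathcal{P}_uF-\mathcal{P}_uF_\Phi\|_{V^p}\le\min\left\{\epsilon\cdot K_{p,\Phi}(F)\cdot C_{p,d}(r),\ \epsilon^{1/p}\cdot\|F\|_{L^1}\right\},$$ where $$K_{p,\Phi}(F)=\min\{\|F\|_{L^p},\|F_\Phi\|_{L^p}\},\qquad C_{p,d}(r)=2^{(p-1)/p}\,r^{(d-1)(p-1)/p}.$$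
   Context: $|\cdot|$ is the Euclidean norm. For $p=\infty$, $1/p=0$ and $(p-1)/p=1$; $\|F_\Phi\|_{L^p}$ may be $+\infty$. An $\epsilon$-deformation $\Phi:B\to A$ is a $C^1$ bijection of $B$ onto $A$ with $\det(\nabla\Phi(x))\ne0$ for all $x\in B$ and $|x-\Phi(x)|\le\epsilon$ for all $x\in B$. Tomographic projection onto the line spanned by a unit vector $u$: with $u_2,\dots,u_d$ an orthonormal basis of $u^\perp$, $$(\mathcal{P}_uF)(t)=\int_{\mathbb{R}^{d-1}}F(tu+s_1u_2+\dots+s_{d-1}u_d)\,ds_1\cdots ds_{d-1}.$$ Volterra $p$-norm: for an integrable function $h$ of one variable supported in $[a,b]$, $(\mathcal{V}h)(x)=\int_a^xh(t)\,dt$ for $x\in[a,b]$ and $\|h\|_{V^p}=\|\mathcal{V}h\|_{L^p([a,b])}$. Here $[a,b]$ is any bounded interval containing the supports of the functions involved (since $\mathcal{P}_uF-\mathcal{P}_uF_\Phi$ has integral $0$, the value does not depend on the choice). *)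

theory Defs
  imports "HOL-Analysis.Analysis" "HOL-Probability.Essential_Supremum"
begin

(* Exponents p range over [1, \<infinity>] in ennreal. The endpoint p = \<infinity> is split off in the two
   definitions below because ennreal arithmetic would give (\<infinity> - 1) / \<infinity> = 0. *)

definition inv_exponent :: "ennreal \<Rightarrow> real" where  \<comment> \<open>$1/p$\<close>
  "inv_exponent p = (if p = \<infinity> then 0 else 1 / enn2real p)"

definition conj_exponent :: "ennreal \<Rightarrow> real" where  \<comment> \<open>$(p-1)/p$\<close>
  "conj_exponent p = (if p = \<infinity> then 1 else (enn2real p - 1) / enn2real p)"

(* The L^p norm takes values in [0, \<infinity>]. *)
definition Lp_norm :: "'a measure \<Rightarrow> ennreal \<Rightarrow> ('a \<Rightarrow> real) \<Rightarrow> ennreal" where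
  "Lp_norm M p f =
     (if p = \<infinity> then esssup M (\<lambda>x. ennreal \<bar>f x\<bar>)
      else let I = (\<integral>\<^sup>+ x. ennreal (\<bar>f x\<bar> powr enn2real p) \<partial>M)
           in if I = \<infinity> then \<infinity> else ennreal (enn2real I powr (1 / enn2real p)))"

definition in_Lp :: "'a measure \<Rightarrow> ennreal \<Rightarrow> ('a \<Rightarrow> real) \<Rightarrow> bool" where
  "in_Lp M p f \<longleftrightarrow> f \<in> borel_measurable M \<and> Lp_norm M p f < \<infinity>"

definition eps_deformation ::
    "real \<Rightarrow> (real^'n) set \<Rightarrow> (real^'n) set \<Rightarrow> (real^'n \<Rightarrow> real^'n) \<Rightarrow> bool" where
  "eps_deformation \<epsilon> B A \<Phi> \<longleftrightarrow>
     bij_betw \<Phi> B A \<and>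
     (\<forall>x\<in>B. \<Phi> differentiable (at x)) \<and>
     continuous_on B (\<lambda>x. jacobian \<Phi> (at x)) \<and>
     (\<forall>x\<in>B. det (jacobian \<Phi> (at x)) \<noteq> 0) \<and>
     (\<forall>x\<in>B. norm (x - \<Phi> x) \<le> \<epsilon>)"

definition deformed ::
    "(real^'n \<Rightarrow> real^'n) \<Rightarrow> (real^'n) set \<Rightarrow> (real^'n \<Rightarrow> real) \<Rightarrow> real^'n \<Rightarrow> real" where
  "deformed \<Phi> B F x = (if x \<in> B then F (\<Phi> x) * \<bar>det (jacobian \<Phi> (at x))\<bar> else 0)"

definition orthonormal_basis_of :: "'a::real_inner set \<Rightarrow> 'a set \<Rightarrow> bool" where
  "orthonormal_basis_of S U \<longleftrightarrow> pairwise orthogonal U \<and> (\<forall>v\<in>U. norm v = 1) \<and> span U = S"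

(* U plays the role of {u_2, ..., u_d}, and s assigns to each of these vectors its coordinate.
   The completion makes the measure Lebesgue rather than Borel, so that F is only required to be
   Lebesgue measurable. For d = 1, U is empty and the integral is evaluation at t u. *)
definition tomographic_projection ::
    "'a::euclidean_space \<Rightarrow> 'a set \<Rightarrow> ('a \<Rightarrow> real) \<Rightarrow> real \<Rightarrow> real" where
  "tomographic_projection u U F t =
     (LINT s | completion (Pi\<^sub>M U (\<lambda>_. lborel)). F (t *\<^sub>R u + (\<Sum>v\<in>U. s v *\<^sub>R v)))"

definition volterra :: "real \<Rightarrow> (real \<Rightarrow> real) \<Rightarrow> real \<Rightarrow> real" where
  "volterra a h x = (LINT t:{a..x}|lebesgue. h t)"

definition volterra_norm :: "real \<Rightarrow> real \<Rightarrow> ennreal \<Rightarrow> (real \<Rightarrow> real) \<Rightarrow> ennreal" where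
  "volterra_norm a b p h = Lp_norm (lebesgue_on {a..b}) p (volterra a h)"

end

theory Submission
  imports Defs
begin

text \<open>
The Volterra transform of a projection is a half-space integral: integrating the projection of a
function along \<open>u\<close> over \<open>t \<le> x\<close> is, by Fubini in orthonormal coordinates, the same as integrating the
function over the points \<open>z\<close> with \<open>z \<bullet> u \<le> x\<close> (\<open>tomographic_projection_Fubini\<close>). Let \<open>W x\<close> be the
transform of the difference of the two projections. The change of variables formula
(\<open>set_integral_change_of_variables\<close>) moves the half-space integral of the deformed density to \<open>A\<close>,
where the half-space is replaced by the set of those \<open>z\<close> whose preimage under \<open>\<Phi>\<close> lies in it. So
\<open>W x\<close> is the difference of the integrals of \<open>F\<close> over two subsets of \<open>A\<close>, and its absolute value is at
most the integral of \<open>|F|\<close> over the set \<open>S x\<close> of points that straddle \<open>x\<close>: exactly one of \<open>z\<close> and its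
preimage has its coordinate along \<open>u\<close> below \<open>x\<close>.

Since the preimage is at distance at most \<open>\<epsilon>\<close> from \<open>z\<close>, the sets \<open>S x\<close> are small in two ways. A fixed
\<open>z\<close> lies in \<open>S x\<close> only for \<open>x\<close> in an interval of length at most \<open>\<epsilon>\<close> (\<open>nn_integral_straddle_le\<close>), and for fixed
\<open>x\<close> the set \<open>S x\<close> lies in a slab of width \<open>2 \<epsilon>\<close> and has diameter at most \<open>r\<close>, so its volume is at most
\<open>2 \<epsilon> r ^ (d - 1)\<close> in dimension \<open>d\<close> (\<open>emeasure_slab_le\<close>). The first fact bounds the integral of \<open>|W|\<close> by \<open>\<epsilon>\<close> times the
L1 norm of \<open>F\<close>; as \<open>|W|\<close> never exceeds that norm, this gives the bound with \<open>\<epsilon> powr (1 / p)\<close>. Combining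
Hoelder's inequality on \<open>S x\<close> (\<open>powr_nn_integral_le\<close>) with both facts bounds the integral of \<open>|W| powr p\<close>
by \<open>(2 \<epsilon> r ^ (d - 1)) powr (p - 1) * \<epsilon>\<close> times the integral of \<open>|F| powr p\<close>, which is the bound with
\<open>C\<close> and the norm of \<open>F\<close>. The whole argument is symmetric: pulling everything back to \<open>B\<close> instead
expresses \<open>W x\<close> through the deformed density, and gives the same bound with its norm. Both
applications are instances of \<open>straddle_Lp_norm_le\<close>.
\<close>

section \<open>Relabelling coordinates by a well-ordered index type\<close>

text \<open>
The change of variables formula and the invariance of Lebesgue measure under orthogonal maps are
stated for vectors indexed by a well-ordered finite type. A copy of \<^typ>\<open>'n\<close> carrying an arbitrary
well-order serves as an intermediate index type: relabelling the coordinates preserves Lebesgue measure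
and determinants, and so transports both facts to vectors indexed by \<^typ>\<open>'n\<close>.
\<close>

typedef 'n wellordered = "UNIV :: 'n set" ..

lemma UNIV_wellordered: "(UNIV :: 'n wellordered set) = range Abs_wellordered"
  by (rule type_definition.Abs_image[OF type_definition_wellordered, symmetric])

instance wellordered :: (finite) finite
  by standard (subst UNIV_wellordered, simp)

instantiation wellordered :: (finite) wellorder
begin

definition less_eq_wellordered :: "'a wellordered \<Rightarrow> 'a wellordered \<Rightarrow> bool" where
  "a \<le> b \<longleftrightarrow> to_nat_on UNIV (Rep_wellordered a) \<le> to_nat_on UNIV (Rep_wellordered b)"

definition less_wellordered :: "'a wellordered \<Rightarrow> 'a wellordered \<Rightarrow> bool" where
  "a < b \<longleftrightarrow> to_nat_on UNIV (Rep_wellordered a) < to_nat_on UNIV (Rep_wellordered b)"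

instance
proof
  fix a b :: "'a wellordered"
  assume "a \<le> b" "b \<le> a"
  then have "to_nat_on UNIV (Rep_wellordered a) = to_nat_on UNIV (Rep_wellordered b)"
    by (simp add: less_eq_wellordered_def)
  then show "a = b"
    using inj_on_to_nat_on[of "UNIV :: 'a set"]
    by (simp add: countable_finite inj_eq Rep_wellordered_inject)
next
  fix P :: "'a wellordered \<Rightarrow> bool" and a
  assume step: "\<And>x. (\<And>y. y < x \<Longrightarrow> P y) \<Longrightarrow> P x"
  show "P a"
  proof (rule measure_induct_rule[where f = "\<lambda>a. to_nat_on UNIV (Rep_wellordered a)"])
    fix x :: "'a wellordered"
    assume IH: "\<And>y. to_nat_on UNIV (Rep_wellordered y) < to_nat_on UNIV (Rep_wellordered x) \<Longrightarrow> P y"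
    show "P x"
      by (rule step, rule IH) (simp only: less_wellordered_def)
  qed
qed (auto simp: less_eq_wellordered_def less_wellordered_def)

end

text \<open>
Such a map is an isometry that takes coordinates to coordinates, so the preimage of a box is the box
with the same side lengths.
\<close>

lemma distr_lborel_basis_map:
  fixes \<rho> :: "'a::euclidean_space \<Rightarrow> 'b::euclidean_space"
  assumes lin: "linear \<rho>" and bij: "bij_betw \<rho> Basis Basis"
  shows "distr lborel borel \<rho> = lborel"
proof (rule sym, rule lborel_eqI)
  have inner: "\<rho> x \<bullet> \<rho> c = x \<bullet> c" if "c \<in> Basis" for x c
  proof -
    have "\<rho> x \<bullet> \<rho> c = \<rho> (\<Sum>b\<in>Basis. (x \<bullet> b) *\<^sub>R b) \<bullet> \<rho> c"
      by (simp add: euclidean_representation)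
    also have "\<dots> = (\<Sum>b\<in>Basis. (x \<bullet> b) * (\<rho> b \<bullet> \<rho> c))"
      by (simp add: linear_sum[OF lin] linear_scale[OF lin] inner_sum_left)
    also have "\<dots> = (\<Sum>b\<in>Basis. if b = c then x \<bullet> c else 0)"
    proof (rule sum.cong[OF refl])
      fix b :: 'a assume b: "b \<in> Basis"
      have "\<rho> b \<in> Basis" "\<rho> c \<in> Basis"
        using bij_betwE[OF bij] b that by simp_all
      moreover have "\<rho> b = \<rho> c \<longleftrightarrow> b = c"
        by (rule inj_on_eq_iff[OF bij_betw_imp_inj_on[OF bij] b that])
      ultimately have "\<rho> b \<bullet> \<rho> c = (if b = c then 1 else 0)"
        by (simp only: inner_Basis)
      then show "(x \<bullet> b) * (\<rho> b \<bullet> \<rho> c) = (if b = c then x \<bullet> c else 0)"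
        by (cases "b = c") simp_all
    qed
    finally show ?thesis
      using that by simp
  qed
  have meas [measurable]: "\<rho> \<in> borel_measurable borel"
    by (intro borel_measurable_continuous_onI linear_continuous_on linear_conv_bounded_linear[THEN iffD1] lin)
  fix l u :: 'b
  assume lu: "\<And>b. b \<in> Basis \<Longrightarrow> l \<bullet> b \<le> u \<bullet> b"
  define pull where "pull w = (\<Sum>c\<in>Basis. (w \<bullet> \<rho> c) *\<^sub>R c)" for w
  have pull: "pull w \<bullet> c = w \<bullet> \<rho> c" if "c \<in> Basis" for w c
    using that by (simp add: pull_def)
  have Basis: "(Basis :: 'b set) = \<rho> ` Basis"
    using bij by (simp add: bij_betw_def)
  have "\<rho> -` box l u = box (pull l) (pull u)"
    by (auto simp: mem_box Basis pull inner)
  then have "emeasure (distr lborel borel \<rho>) (box l u) = emeasure lborel (box (pull l) (pull u))"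
    by (simp add: emeasure_distr)
  also have "\<dots> = (\<Prod>c\<in>Basis. (pull u - pull l) \<bullet> c)"
    using lu by (intro emeasure_lborel_box) (auto simp: pull Basis)
  also have "\<dots> = (\<Prod>c\<in>Basis. (u - l) \<bullet> \<rho> c)"
    by (simp add: pull inner_diff_left)
  also have "\<dots> = (\<Prod>b\<in>Basis. (u - l) \<bullet> b)"
    by (simp add: prod.reindex_bij_betw[OF bij, of "\<lambda>b. (u - l) \<bullet> b"])
  finally show "emeasure (distr lborel borel \<rho>) (box l u) = (\<Prod>b\<in>Basis. (u - l) \<bullet> b)" .
qed simp

definition relabel :: "real^'n \<Rightarrow> real^'n wellordered" where
  "relabel x = (\<chi> j. x $ Rep_wellordered j)"

definition unlabel :: "real^'n wellordered \<Rightarrow> real^'n" where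
  "unlabel y = (\<chi> i. y $ Abs_wellordered i)"

lemma unlabel_relabel [simp]: "unlabel (relabel x) = x"
  by (simp add: unlabel_def relabel_def vec_eq_iff Abs_wellordered_inverse)

lemma relabel_unlabel [simp]: "relabel (unlabel y) = y"
  by (simp add: unlabel_def relabel_def vec_eq_iff Rep_wellordered_inverse)

lemma linear_relabel: "linear (relabel :: real^'n \<Rightarrow> _)"
  by (rule linearI) (simp_all add: relabel_def vec_eq_iff)

lemma linear_unlabel: "linear (unlabel :: _ \<Rightarrow> real^'n)"
  by (rule linearI) (simp_all add: unlabel_def vec_eq_iff)

lemma sum_wellordered: "(\<Sum>j\<in>UNIV. f (Rep_wellordered j)) = (\<Sum>i\<in>UNIV. f i)"
  by (rule sum.reindex_bij_witness[where i=Abs_wellordered and j=Rep_wellordered])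
     (auto simp: Rep_wellordered_inverse Abs_wellordered_inverse)

lemma prod_wellordered: "(\<Prod>j\<in>UNIV. f (Rep_wellordered j)) = (\<Prod>i\<in>UNIV. f i)"
  by (rule prod.reindex_bij_witness[where i=Abs_wellordered and j=Rep_wellordered])
     (auto simp: Rep_wellordered_inverse Abs_wellordered_inverse)

lemma norm_relabel [simp]: "norm (relabel x) = norm (x :: real^'n)"
  by (simp add: norm_vec_def L2_set_def relabel_def sum_wellordered[where f="\<lambda>i. (x $ i)\<^sup>2"])

lemma relabel_axis: "relabel (axis i c) = axis (Abs_wellordered i) c"
  by (auto simp: relabel_def axis_def vec_eq_iff Abs_wellordered_inverse Rep_wellordered_inverse)

lemma bij_relabel_Basis: "bij_betw relabel (Basis :: (real^'n) set) Basis"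
proof -
  have "relabel ` (Basis :: (real^'n) set) = Basis"
    by (auto simp: Basis_vec_def relabel_axis image_iff) (metis Rep_wellordered_inverse)
  moreover have "inj relabel"
    by (metis injI unlabel_relabel)
  ultimately show ?thesis
    by (metis bij_betw_def inj_on_subset subset_UNIV)
qed

lemma distr_relabel: "distr lborel borel (relabel :: real^'n \<Rightarrow> _) = lborel"
  by (rule distr_lborel_basis_map[OF linear_relabel bij_relabel_Basis])

lemma bij_unlabel_Basis: "bij_betw unlabel Basis (Basis :: (real^'n::finite) set)"
proof -
  have "relabel ` (Basis :: (real^'n) set) = Basis"
    using bij_relabel_Basis by (rule bij_betw_imp_surj_on)
  then have "unlabel ` Basis = unlabel ` relabel ` (Basis :: (real^'n) set)"
    by (simp only:)
  then have "unlabel ` Basis = (Basis :: (real^'n) set)"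
    by (simp only: image_image unlabel_relabel image_ident)
  moreover have "inj_on unlabel Basis"
    by (rule inj_on_inverseI[where g = relabel]) simp
  ultimately show ?thesis
    by (intro bij_betw_imageI)
qed

lemma distr_unlabel: "distr lborel borel (unlabel :: _ \<Rightarrow> real^'n) = lborel"
  by (rule distr_lborel_basis_map[OF linear_unlabel bij_unlabel_Basis])

text \<open>
Conjugating the permutations in the Leibniz expansion by the relabelling is a bijection that
preserves signs.
\<close>

lemma det_relabel:
  fixes A :: "real^'n^'n"
  shows "det (\<chi> i j. A $ Rep_wellordered i $ Rep_wellordered j) = det A"
proof -
  let ?W = "UNIV :: 'n wellordered set"
  have "det (\<chi> i j. A $ Rep_wellordered i $ Rep_wellordered j)
    = (\<Sum>p | p permutes ?W. of_int (sign p) *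
        (\<Prod>i\<in>?W. A $ Rep_wellordered i $ Rep_wellordered (p i)))"
    by (simp add: det_def)
  also have "\<dots> = (\<Sum>q | q permutes (UNIV :: 'n set). of_int (sign q) * (\<Prod>i\<in>UNIV. A $ i $ q i))"
  proof -
    have bR: "bij (Rep_wellordered :: 'n wellordered \<Rightarrow> 'n)"
      by (rule bij_betw_byWitness[of _ Abs_wellordered]) (auto simp: Rep_wellordered_inverse Abs_wellordered_inverse)
    have bA: "bij (Abs_wellordered :: 'n \<Rightarrow> _)"
      by (rule bij_betw_byWitness[of _ Rep_wellordered]) (auto simp: Rep_wellordered_inverse Abs_wellordered_inverse)
    show ?thesis
    proof (rule sum.reindex_bij_witness[where
        i = "\<lambda>q. Abs_wellordered \<circ> q \<circ> Rep_wellordered" and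
        j = "\<lambda>p. Rep_wellordered \<circ> p \<circ> Abs_wellordered"])
      fix p assume p: "p \<in> {p. p permutes ?W}"
      show "Abs_wellordered \<circ> (Rep_wellordered \<circ> p \<circ> Abs_wellordered) \<circ> Rep_wellordered = p"
        by (simp add: fun_eq_iff Rep_wellordered_inverse)
      show "Rep_wellordered \<circ> p \<circ> Abs_wellordered \<in> {q. q permutes UNIV}"
        using p bA bR by (auto intro!: bij_imp_permutes bij_comp dest: permutes_bij)
      have "inv Rep_wellordered = (Abs_wellordered :: 'n \<Rightarrow> _)"
        by (rule inv_equality) (simp_all add: Rep_wellordered_inverse Abs_wellordered_inverse)
      then have "map_permutation UNIV Rep_wellordered p = Rep_wellordered \<circ> p \<circ> Abs_wellordered"
        using bR by (simp add: map_permutation_def bij_is_surj restrict_id_def fun_eq_iff)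
      then have "sign (Rep_wellordered \<circ> p \<circ> Abs_wellordered) = sign p"
        using sign_map_permutation[of Rep_wellordered ?W p] p bR by (simp add: bij_is_inj)
      moreover have "(\<Prod>i\<in>UNIV. A $ i $ (Rep_wellordered \<circ> p \<circ> Abs_wellordered) i) =
          (\<Prod>i\<in>?W. A $ Rep_wellordered i $ Rep_wellordered (p i))"
        by (subst prod_wellordered[symmetric]) (simp add: Rep_wellordered_inverse)
      ultimately show "of_int (sign (Rep_wellordered \<circ> p \<circ> Abs_wellordered)) *
          (\<Prod>i\<in>UNIV. A $ i $ (Rep_wellordered \<circ> p \<circ> Abs_wellordered) i) =
          of_int (sign p) * (\<Prod>i\<in>?W. A $ Rep_wellordered i $ Rep_wellordered (p i))"
        by simp
    next
      fix q assume q: "q \<in> {q. q permutes (UNIV :: 'n set)}"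
      show "Rep_wellordered \<circ> (Abs_wellordered \<circ> q \<circ> Rep_wellordered) \<circ> Abs_wellordered = q"
        by (simp add: fun_eq_iff Abs_wellordered_inverse)
      show "Abs_wellordered \<circ> q \<circ> Rep_wellordered \<in> {p. p permutes ?W}"
        using q bA bR by (auto intro!: bij_imp_permutes bij_comp dest: permutes_bij)
    qed
  qed
  finally show ?thesis
    by (simp add: det_def)
qed

lemma measurable_relabel [measurable]: "relabel \<in> borel_measurable borel"
  by (intro borel_measurable_continuous_onI linear_continuous_on linear_conv_bounded_linear[THEN iffD1] linear_relabel)

lemma measurable_unlabel [measurable]: "unlabel \<in> borel_measurable borel"
  by (intro borel_measurable_continuous_onI linear_continuous_on linear_conv_bounded_linear[THEN iffD1] linear_unlabel)

lemma norm_unlabel [simp]: "norm (unlabel y :: real^'n) = norm y"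
  by (metis norm_relabel relabel_unlabel)

section \<open>Lebesgue measure in orthonormal coordinates\<close>

lemma distr_lborel_orthogonal_wellorder:
  fixes f :: "real^'m::{finite,wellorder} \<Rightarrow> real^'m::_"
  assumes f: "orthogonal_transformation f"
  shows "distr lborel borel f = lborel"
proof (rule sym, rule lborel_eqI)
  have [measurable]: "f \<in> borel_measurable borel"
    by (intro borel_measurable_continuous_onI linear_continuous_on linear_conv_bounded_linear[THEN iffD1]
        orthogonal_transformation_linear f)
  fix l u :: "real^'m::_"
  assume lu: "\<And>b. b \<in> Basis \<Longrightarrow> l \<bullet> b \<le> u \<bullet> b"
  have eq: "f -` box l u = inv f ` box l u"
    by (rule bij_vimage_eq_inv_image[OF orthogonal_transformation_bij[OF f]])
  have inv: "orthogonal_transformation (inv f)"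
    by (rule orthogonal_transformation_inv[OF f])
  have lm: "inv f ` box l u \<in> lmeasurable"
    by (rule measurable_orthogonal_image[OF inv]) simp
  have borel: "f -` box l u \<in> sets borel"
    using measurable_sets[of f borel borel "box l u"] by simp
  have "emeasure (distr lborel borel f) (box l u) = emeasure lebesgue (inv f ` box l u)"
    using borel by (simp add: emeasure_distr eq)
  also have "\<dots> = measure lebesgue (box l u)"
    using lm measure_orthogonal_image[OF inv, of "box l u"]
    by (simp add: emeasure_eq_measure2)
  also have "\<dots> = (\<Prod>b\<in>Basis. (u - l) \<bullet> b)"
    using lu by (simp add: measure_lborel_box)
  finally show "emeasure (distr lborel borel f) (box l u) = (\<Prod>b\<in>Basis. (u - l) \<bullet> b)" .
qed simp

text \<open>
Conjugation by the relabelling makes the map an orthogonal map over a well-ordered index type.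
\<close>

lemma distr_lborel_orthogonal:
  fixes f :: "real^'n \<Rightarrow> real^'n"
  assumes f: "orthogonal_transformation f"
  shows "distr lborel borel f = lborel"
proof -
  define g where "g = relabel \<circ> f \<circ> unlabel"
  have g: "orthogonal_transformation g"
    using f unfolding g_def orthogonal_transformation
    by (auto intro!: linear_compose linear_relabel linear_unlabel)
  have [measurable]: "g \<in> borel_measurable borel"
    by (intro borel_measurable_continuous_onI linear_continuous_on linear_conv_bounded_linear[THEN iffD1]
        orthogonal_transformation_linear g)
  have "f = unlabel \<circ> g \<circ> relabel"
    by (simp add: g_def fun_eq_iff)
  then have "distr lborel borel f = distr (distr (distr lborel borel relabel) borel g) borel unlabel"
    by (simp add: distr_distr comp_assoc)
  also have "\<dots> = lborel"
    by (simp add: distr_relabel distr_lborel_orthogonal_wellorder[OF g] distr_unlabel)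
  finally show ?thesis .
qed

text \<open>
Lebesgue measure is the product of one line and the remaining lines, the line \<^term>\<open>k\<close> being singled
out because it will carry the variable of the projection. The check on boxes is a product of lengths.
\<close>

lemma distr_basis_coordinates:
  fixes \<sigma> :: "'i \<Rightarrow> 'a::euclidean_space"
  assumes I: "finite I" "k \<notin> I" and bij: "bij_betw \<sigma> (insert k I) Basis"
  shows "distr (lborel \<Otimes>\<^sub>M Pi\<^sub>M I (\<lambda>_. lborel)) borel (\<lambda>(t, s). t *\<^sub>R \<sigma> k + (\<Sum>i\<in>I. s i *\<^sub>R \<sigma> i)) = lborel"
proof (rule sym, rule lborel_eqI)
  interpret P: product_sigma_finite "\<lambda>_::'i. lborel :: real measure"
    by standard
  interpret F: finite_product_sigma_finite "\<lambda>_::'i. lborel :: real measure" I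
    by standard (rule I)
  let ?\<phi> = "\<lambda>(t, s). t *\<^sub>R \<sigma> k + (\<Sum>i\<in>I. s i *\<^sub>R \<sigma> i)"
  have coord: "?\<phi> (t, s) \<bullet> \<sigma> i = (if i = k then t else s i)" if "i \<in> insert k I" for t s i
  proof -
    have *: "\<sigma> j \<bullet> \<sigma> i = (if j = i then 1 else 0)" if "j \<in> insert k I" for j
      using bij_betwE[OF bij] inj_on_eq_iff[OF bij_betw_imp_inj_on[OF bij] that \<open>i \<in> insert k I\<close>]
        that \<open>i \<in> insert k I\<close>
      by (metis inner_Basis)
    have "(\<Sum>j\<in>I. s j * (\<sigma> j \<bullet> \<sigma> i)) = (\<Sum>j\<in>I. if j = i then s i else 0)"
      by (intro sum.cong) (auto simp: *)
    then show ?thesis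
      using that I by (auto simp: inner_add_left inner_sum_left *)
  qed
  fix l u :: 'a
  assume lu: "\<And>b. b \<in> Basis \<Longrightarrow> l \<bullet> b \<le> u \<bullet> b"
  have Basis: "(Basis :: 'a set) = \<sigma> ` insert k I"
    using bij by (rule bij_betw_imp_surj_on[symmetric])
  have "?\<phi> -` box l u \<inter> space (lborel \<Otimes>\<^sub>M Pi\<^sub>M I (\<lambda>_. lborel)) =
      {l \<bullet> \<sigma> k<..<u \<bullet> \<sigma> k} \<times> Pi\<^sub>E I (\<lambda>i. {l \<bullet> \<sigma> i<..<u \<bullet> \<sigma> i})" (is "?L = ?R")
  proof (rule set_eqI)
    fix x :: "real \<times> ('i \<Rightarrow> real)"
    obtain t s where x: "x = (t, s)" by (cases x)
    have "?\<phi> (t, s) \<in> box l u \<longleftrightarrow>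
        (\<forall>i\<in>insert k I. l \<bullet> \<sigma> i < (if i = k then t else s i) \<and> (if i = k then t else s i) < u \<bullet> \<sigma> i)"
      unfolding mem_box Basis ball_simps(9) using coord by (intro ball_cong refl) simp
    then show "x \<in> ?L \<longleftrightarrow> x \<in> ?R"
      using I(2) by (auto simp: x space_pair_measure space_PiM PiE_iff)
  qed
  then have "emeasure (distr (lborel \<Otimes>\<^sub>M Pi\<^sub>M I (\<lambda>_. lborel)) borel ?\<phi>) (box l u) =
      emeasure (lborel \<Otimes>\<^sub>M Pi\<^sub>M I (\<lambda>_. lborel)) ({l \<bullet> \<sigma> k<..<u \<bullet> \<sigma> k} \<times> Pi\<^sub>E I (\<lambda>i. {l \<bullet> \<sigma> i<..<u \<bullet> \<sigma> i}))"
    by (subst emeasure_distr) (simp_all only:, measurable)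
  also have "\<dots> = emeasure lborel {l \<bullet> \<sigma> k<..<u \<bullet> \<sigma> k} * (\<Prod>i\<in>I. emeasure lborel {l \<bullet> \<sigma> i<..<u \<bullet> \<sigma> i})"
    using I(1) by (simp add: F.emeasure_pair_measure_Times P.emeasure_PiM sets_PiM_I_finite)
  also have "\<dots> = (\<Prod>i\<in>insert k I. ennreal ((u - l) \<bullet> \<sigma> i))"
    using I lu by (simp add: Basis inner_diff_left)
  also have "\<dots> = ennreal (\<Prod>i\<in>insert k I. (u - l) \<bullet> \<sigma> i)"
    using lu by (intro prod_ennreal) (auto simp: Basis inner_diff_left)
  also have "(\<Prod>i\<in>insert k I. (u - l) \<bullet> \<sigma> i) = (\<Prod>b\<in>Basis. (u - l) \<bullet> b)"
    by (rule prod.reindex_bij_betw[OF bij])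
  finally show "emeasure (distr (lborel \<Otimes>\<^sub>M Pi\<^sub>M I (\<lambda>_. lborel)) borel ?\<phi>) (box l u) =
      (\<Prod>b\<in>Basis. (u - l) \<bullet> b)" .
qed simp

text \<open>
Every vector is a multiple of \<^term>\<open>u\<close> plus a vector orthogonal to \<^term>\<open>u\<close>, so \<^term>\<open>insert u U\<close> is
an orthonormal basis of the whole space, which determines its cardinality.
\<close>

lemma orthonormal_basis_of_complement:
  fixes u :: "'a::euclidean_space"
  assumes u: "norm u = 1" and U: "orthonormal_basis_of (orthogonal_comp {u}) U"
  shows "finite U" "u \<notin> U" "pairwise orthogonal (insert u U)" "\<And>v. v \<in> insert u U \<Longrightarrow> norm v = 1"
    "card (insert u U) = DIM('a)"
proof -
  have span: "span U = {x. u \<bullet> x = 0}"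
    using U by (auto simp: orthonormal_basis_of_def orthogonal_comp_def orthogonal_def)
  then have perp: "u \<bullet> v = 0" if "v \<in> U" for v
    using that span_base by blast
  show n: "\<And>v. v \<in> insert u U \<Longrightarrow> norm v = 1"
    using u U by (auto simp: orthonormal_basis_of_def)
  show "u \<notin> U"
    using perp[of u] u by (auto simp: norm_eq_1)
  show p: "pairwise orthogonal (insert u U)"
    using U perp by (auto simp: orthonormal_basis_of_def pairwise_insert orthogonal_def inner_commute)
  have ind: "independent (insert u U)"
    using p n[of 0] by (intro pairwise_orthogonal_independent) auto
  show "finite U"
    using independent_imp_finite[OF ind] by simp
  have "x \<in> span (insert u U)" for x
  proof -
    have "x - (x \<bullet> u) *\<^sub>R u \<in> span U"
      using u by (simp add: span inner_diff_right norm_eq_1 inner_commute)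
    then show ?thesis
      by (auto simp: span_insert)
  qed
  then have "span (insert u U) = UNIV"
    by blast
  then show "card (insert u U) = DIM('a)"
    using dim_eq_card[of "insert u U" UNIV] ind by (simp add: dim_UNIV)
qed

text \<open>
An orthogonal map takes the standard basis to the orthonormal basis formed by \<^term>\<open>u\<close> and \<^term>\<open>U\<close>.
Composing it with the coordinate map of the standard basis gives the map below, and both factors
preserve Lebesgue measure.
\<close>

lemma distr_orthonormal_coordinates:
  fixes u :: "real^'n"
  assumes u: "norm u = 1" and U: "orthonormal_basis_of (orthogonal_comp {u}) U"
  shows "distr (lborel \<Otimes>\<^sub>M Pi\<^sub>M U (\<lambda>_. lborel)) borel (\<lambda>(t, s). t *\<^sub>R u + (\<Sum>v\<in>U. s v *\<^sub>R v)) = lborel"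
proof -
  note basis = orthonormal_basis_of_complement[OF u U]
  obtain \<sigma> where \<sigma>: "bij_betw \<sigma> (insert u U) (Basis :: (real^'n) set)"
    using finite_same_card_bij[of "insert u U" "Basis :: (real^'n) set"] basis by auto
  define T where "T x = (\<Sum>v\<in>insert u U. (x \<bullet> \<sigma> v) *\<^sub>R v)" for x
  have "linear T"
    unfolding T_def
    by (rule linearI) (simp_all add: inner_add_left scaleR_add_left sum.distrib scaleR_sum_right)
  moreover have "norm (T x) = norm x" for x
  proof -
    have "(norm (T x))\<^sup>2 = (\<Sum>v\<in>insert u U. (norm ((x \<bullet> \<sigma> v) *\<^sub>R v))\<^sup>2)"
      unfolding T_def using basis(1,3)
      by (intro norm_sum_Pythagorean) (auto simp: pairwise_def orthogonal_def)
    also have "\<dots> = (\<Sum>v\<in>insert u U. (x \<bullet> \<sigma> v)\<^sup>2)"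
      using basis(4) by (intro sum.cong) (auto)
    also have "\<dots> = (\<Sum>b\<in>Basis. (x \<bullet> b)\<^sup>2)"
      by (rule sum.reindex_bij_betw[OF \<sigma>])
    also have "\<dots> = (norm x)\<^sup>2"
      unfolding power2_norm_eq_inner by (subst euclidean_inner[of x x]) (simp add: power2_eq_square)
    finally show ?thesis
      by simp
  qed
  ultimately have T: "orthogonal_transformation T"
    by (simp add: orthogonal_transformation)
  have [measurable]: "T \<in> borel_measurable borel"
    by (intro borel_measurable_continuous_onI linear_continuous_on linear_conv_bounded_linear[THEN iffD1] \<open>linear T\<close>)
  have T\<sigma>: "T (\<sigma> w) = w" if w: "w \<in> insert u U" for w
  proof -
    have "T (\<sigma> w) = (\<Sum>v\<in>insert u U. if v = w then w else 0)"
      unfolding T_def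
    proof (rule sum.cong[OF refl])
      fix v assume v: "v \<in> insert u U"
      have "\<sigma> w \<bullet> \<sigma> v = (if v = w then 1 else 0)"
        using bij_betwE[OF \<sigma>] inj_on_eq_iff[OF bij_betw_imp_inj_on[OF \<sigma>] w v] v w
        by (auto simp: inner_Basis)
      then show "(\<sigma> w \<bullet> \<sigma> v) *\<^sub>R v = (if v = w then w else 0)"
        by simp
    qed
    then show ?thesis
      using w basis(1) by (simp add: sum.delta)
  qed
  let ?\<phi> = "\<lambda>(t, s). t *\<^sub>R u + (\<Sum>v\<in>U. s v *\<^sub>R v)"
  let ?\<psi> = "\<lambda>(t, s). t *\<^sub>R \<sigma> u + (\<Sum>v\<in>U. s v *\<^sub>R \<sigma> v)"
  have "?\<phi> = T \<circ> ?\<psi>"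
    by (auto simp: fun_eq_iff linear_add[OF \<open>linear T\<close>] linear_sum[OF \<open>linear T\<close>] linear_scale[OF \<open>linear T\<close>] T\<sigma>)
  then have "distr (lborel \<Otimes>\<^sub>M Pi\<^sub>M U (\<lambda>_. lborel)) borel ?\<phi> =
      distr (distr (lborel \<Otimes>\<^sub>M Pi\<^sub>M U (\<lambda>_. lborel)) borel ?\<psi>) borel T"
    by (simp only:) (rule distr_distr[symmetric]; measurable)
  then show ?thesis
    by (simp only: distr_basis_coordinates[OF basis(1,2) \<sigma>] distr_lborel_orthogonal[OF T])
qed

section \<open>Change of variables\<close>

text \<open>
The real-valued form of the theorem for vector-valued integrands, by reading the values as vectors
with one component.
\<close>

lemma set_integral_change_of_variables_wellorder:
  fixes f :: "real^'m::{finite,wellorder} \<Rightarrow> real" and g :: "real^'m::_ \<Rightarrow> real^'m::_"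
  assumes S: "S \<in> sets lebesgue"
    and der: "\<And>x. x \<in> S \<Longrightarrow> (g has_derivative g' x) (at x within S)"
    and inj: "inj_on g S"
    and f: "set_integrable lebesgue (g ` S) f"
  shows "set_integrable lebesgue S (\<lambda>x. \<bar>det (matrix (g' x))\<bar> * f (g x))"
    and "(LINT x:S|lebesgue. \<bar>det (matrix (g' x))\<bar> * f (g x)) = (LINT x:g ` S|lebesgue. f x)"
proof -
  have "(\<lambda>x. vec (f x) :: real^1) absolutely_integrable_on g ` S"
    using f by (simp add: absolutely_integrable_on_1_iff)
  then have *: "(\<lambda>x. \<bar>det (matrix (g' x))\<bar> *\<^sub>R (vec (f (g x)) :: real^1)) absolutely_integrable_on S"
    "integral S (\<lambda>x. \<bar>det (matrix (g' x))\<bar> *\<^sub>R (vec (f (g x)) :: real^1)) = integral (g ` S) (\<lambda>x. vec (f x))"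
    using has_absolute_integral_change_of_variables[OF S der inj, where f = "\<lambda>x. vec (f x) :: real^1"
        and b = "integral (g ` S) (\<lambda>x. vec (f x))"] by auto
  then show 1: "set_integrable lebesgue S (\<lambda>x. \<bar>det (matrix (g' x))\<bar> * f (g x))"
    by (simp add: absolutely_integrable_on_1_iff)
  show "(LINT x:S|lebesgue. \<bar>det (matrix (g' x))\<bar> * f (g x)) = (LINT x:g ` S|lebesgue. f x)"
    using *(2) by (simp add: integral_on_1_eq set_lebesgue_integral_eq_integral(2)[OF 1]
        set_lebesgue_integral_eq_integral(2)[OF f])
qed

text \<open>
A map that preserves Borel-Lebesgue measure pulls null sets back to null sets, hence is also
measurable for, and preserves, the completion.
\<close>

lemma distr_lebesgue:
  fixes \<rho> :: "'a::euclidean_space \<Rightarrow> 'b::euclidean_space"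
  assumes [measurable]: "\<rho> \<in> borel_measurable borel" and d: "distr lborel borel \<rho> = lborel"
  shows "\<rho> \<in> lebesgue \<rightarrow>\<^sub>M lebesgue" and "distr lebesgue lebesgue \<rho> = lebesgue"
proof -
  have m: "\<rho> \<in> lebesgue \<rightarrow>\<^sub>M lborel"
    by (simp add: measurable_completion)
  have "distr lborel lborel \<rho> = lborel"
    using d by (metis distr_cong sets_lborel)
  then have e: "distr lebesgue lborel \<rho> = lborel"
    by (subst distr_completion) simp_all
  show "\<rho> \<in> lebesgue \<rightarrow>\<^sub>M lebesgue"
    by (rule completion.measurable_completion2[OF m]) (simp add: e)
  show "distr lebesgue lebesgue \<rho> = lebesgue"
    using completion.completion_distr_eq[OF m] by (simp add: e)
qed

lemma matrix_relabel:
  fixes A :: "real^'n^'n"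
  shows "matrix (\<lambda>h. relabel (A *v unlabel h)) = (\<chi> i j. A $ Rep_wellordered i $ Rep_wellordered j)"
proof -
  have "relabel (A *v unlabel h) = (\<chi> i j. A $ Rep_wellordered i $ Rep_wellordered j) *v h" for h
    by (simp add: relabel_def unlabel_def matrix_vector_mult_def vec_eq_iff
        sum_wellordered[where f = "\<lambda>j. A $ _ $ j * h $ Abs_wellordered j", symmetric] Rep_wellordered_inverse)
  then show ?thesis
    by (simp add: matrix_of_matrix_vector_mul)
qed

lemma set_integral_change_of_variables:
  fixes f :: "real^'n \<Rightarrow> real" and g :: "real^'n \<Rightarrow> real^'n" and J :: "real^'n \<Rightarrow> real^'n^'n"
  assumes S: "S \<in> sets lebesgue"
    and der: "\<And>x. x \<in> S \<Longrightarrow> (g has_derivative (\<lambda>h. J x *v h)) (at x)"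
    and inj: "inj_on g S"
    and f: "set_integrable lebesgue (g ` S) f"
  shows "set_integrable lebesgue S (\<lambda>x. \<bar>det (J x)\<bar> * f (g x))"
    and "(LINT x:S|lebesgue. \<bar>det (J x)\<bar> * f (g x)) = (LINT x:g ` S|lebesgue. f x)"
proof -
  note R = distr_lebesgue[OF measurable_relabel distr_relabel, where ?'n1 = 'n]
  note U = distr_lebesgue[OF measurable_unlabel distr_unlabel, where ?'n1 = 'n]
  let ?S = "unlabel -` S :: (real^'n wellordered) set"
  define g' where "g' = relabel \<circ> g \<circ> unlabel"
  define f' where "f' = f \<circ> unlabel"
  have S': "?S \<in> sets lebesgue"
    using measurable_sets[OF U(1) S] by simp
  have gS': "g' ` ?S = unlabel -` (g ` S)"
  proof -
    have "unlabel -` T = relabel ` T" for T :: "(real^'n) set"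
      by (auto simp: image_iff) (metis relabel_unlabel)
    then show ?thesis
      by (simp add: g'_def image_comp o_def)
  qed
  have inj': "inj_on g' ?S"
    using inj by (auto simp: inj_on_def g'_def) (metis relabel_unlabel unlabel_relabel)
  have der': "(g' has_derivative (\<lambda>h. relabel (J (unlabel y) *v unlabel h))) (at y within ?S)" if "y \<in> ?S" for y
  proof -
    have u: "(unlabel has_derivative unlabel) (at y within ?S)"
      by (rule linear_imp_has_derivative[OF linear_unlabel])
    have "(g \<circ> unlabel has_derivative (\<lambda>h. J (unlabel y) *v h) \<circ> unlabel) (at y within ?S)"
      by (rule diff_chain_within[OF u]) (rule has_derivative_at_withinI, rule der, use that in simp)
    from diff_chain_within[OF this linear_imp_has_derivative[OF linear_relabel]]
    show ?thesis
      by (simp add: g'_def o_def)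
  qed
  have f': "integrable lebesgue (\<lambda>y. indicator (g' ` ?S) y *\<^sub>R f' y)"
    "(LINT y|lebesgue. indicator (g' ` ?S) y *\<^sub>R f' y) = (LINT x|lebesgue. indicator (g ` S) x *\<^sub>R f x)"
  proof -
    let ?F = "\<lambda>x. indicator (g ` S) x *\<^sub>R f x"
    have F: "integrable (distr lebesgue lebesgue unlabel) ?F"
      using f by (simp add: U set_integrable_def)
    have e: "(\<lambda>y. indicator (g' ` ?S) y *\<^sub>R f' y) = (\<lambda>y. ?F (unlabel y))"
      by (simp add: fun_eq_iff gS' f'_def indicator_vimage[unfolded o_def, symmetric] indicator_def)
    show "integrable lebesgue (\<lambda>y. indicator (g' ` ?S) y *\<^sub>R f' y)"
      unfolding e by (rule integrable_distr[OF U(1) F])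
    show "(LINT y|lebesgue. indicator (g' ` ?S) y *\<^sub>R f' y) = (LINT x|lebesgue. ?F x)"
      unfolding e using integral_distr[OF U(1), of ?F] F by (simp add: U)
  qed
  have det: "det (matrix (\<lambda>h. relabel (J (unlabel y) *v unlabel h))) = det (J (unlabel y))" for y
    by (simp only: matrix_relabel det_relabel)
  note cv = set_integral_change_of_variables_wellorder[OF S' der' inj',
      unfolded det set_integrable_def set_lebesgue_integral_def, OF _ f'(1)]
  let ?G = "\<lambda>y. indicator ?S y *\<^sub>R (\<bar>det (J (unlabel y))\<bar> * f' (g' y))"
  have G: "integrable (distr lebesgue lebesgue relabel) ?G"
    using cv(1) by (simp add: R)
  have e: "(\<lambda>x. indicator S x *\<^sub>R (\<bar>det (J x)\<bar> * f (g x))) = (\<lambda>x. ?G (relabel x))"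
    by (simp add: fun_eq_iff f'_def g'_def indicator_def)
  show "set_integrable lebesgue S (\<lambda>x. \<bar>det (J x)\<bar> * f (g x))"
    unfolding set_integrable_def e by (rule integrable_distr[OF R(1) G])
  show "(LINT x:S|lebesgue. \<bar>det (J x)\<bar> * f (g x)) = (LINT x:g ` S|lebesgue. f x)"
    unfolding set_lebesgue_integral_def e using integral_distr[OF R(1), of ?G] G cv(2) f'(2) by (simp add: R)
qed

section \<open>Half-line integrals of tomographic projections\<close>

text \<open>
In a complete measure space a function that agrees almost everywhere with a measurable one is
measurable, because preimages change only by null sets.
\<close>

lemma (in complete_measure) measurable_AE_cong:
  assumes f: "f \<in> M \<rightarrow>\<^sub>M N" and ae: "AE x in M. f x = g x" and space: "g \<in> space M \<rightarrow> space N"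
  shows "g \<in> M \<rightarrow>\<^sub>M N"
proof (rule measurableI)
  fix A assume "A \<in> sets N"
  then have fA: "f -` A \<inter> space M \<in> sets M"
    by (rule measurable_sets[OF f])
  have "AE x in M. x \<in> f -` A \<inter> space M \<longleftrightarrow> x \<in> g -` A \<inter> space M"
    using ae by eventually_elim auto
  from in_sets_AE[OF this fA] show "g -` A \<inter> space M \<in> sets M"
    by simp
qed (use space in auto)

lemma completion_measurable_AE_cong:
  fixes f :: "'a \<Rightarrow> real"
  assumes "f \<in> borel_measurable M" and "AE x in M. f x = g x"
  shows "g \<in> borel_measurable (completion M)"
  by (rule completion.measurable_AE_cong[of f])
     (use assms in \<open>auto intro: measurable_completion AE_completion\<close>)

text \<open>
The means of passing from a Lebesgue measurable function to a Borel representative, for which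
Fubini's theorem and the transport of measures are available.
\<close>

lemma integral_completion_AE_cong:
  fixes f :: "'a \<Rightarrow> real"
  assumes f: "f \<in> borel_measurable M" and ae: "AE x in M. f x = g x"
  shows "integrable (completion M) g \<longleftrightarrow> integrable M f"
    and "integral\<^sup>L (completion M) g = integral\<^sup>L M f"
proof -
  note g = completion_measurable_AE_cong[OF f ae]
  note f' = measurable_completion[OF f]
  have ae': "AE x in completion M. g x = f x"
    using AE_completion[OF ae] by eventually_elim simp
  show "integrable (completion M) g \<longleftrightarrow> integrable M f"
    using integrable_cong_AE[OF g f' ae'] by (simp add: integrable_completion[OF f])
  show "integral\<^sup>L (completion M) g = integral\<^sup>L M f"
    using integral_cong_AE[OF g f' ae'] by (simp add: integral_completion[OF f])
qed

text \<open>
By Fubini in the orthonormal coordinates, integrating the projection over a half-line integrates the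
function over the corresponding half-space. This is what turns the Volterra transform of a projection
into half-space integrals. The work lies in the exceptional sets: a Borel representative of \<^term>\<open>G\<close>
agrees with \<^term>\<open>G\<close> almost everywhere on almost every hyperplane orthogonal to \<^term>\<open>u\<close>, and on
these hyperplanes the two projections coincide.
\<close>

lemma tomographic_projection_Fubini:
  fixes u :: "real^'n"
  assumes u: "norm u = 1" and U: "orthonormal_basis_of (orthogonal_comp {u}) U"
    and G: "integrable lebesgue G"
  shows "integrable lebesgue (tomographic_projection u U G)"
    and "(LINT t:{..x}|lebesgue. tomographic_projection u U G t) = (LINT z:{z. z \<bullet> u \<le> x}|lebesgue. G z)"
proof -
  note basis = orthonormal_basis_of_complement[OF u U]
  let ?P = "Pi\<^sub>M U (\<lambda>_. lborel :: real measure)"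
  let ?\<phi> = "\<lambda>(t, s). t *\<^sub>R u + (\<Sum>v\<in>U. s v *\<^sub>R v)"
  interpret S: product_sigma_finite "\<lambda>_::real^'n. lborel :: real measure"
    by standard
  interpret F: finite_product_sigma_finite "\<lambda>_::real^'n. lborel :: real measure" U
    by standard (rule basis)
  interpret Q: pair_sigma_finite "lborel :: real measure" ?P
    by standard
  note distr = distr_orthonormal_coordinates[OF u U]
  have \<phi> [measurable]: "?\<phi> \<in> lborel \<Otimes>\<^sub>M ?P \<rightarrow>\<^sub>M borel"
    by measurable
  obtain G' where G' [measurable]: "G' \<in> borel_measurable borel" and ae: "AE z in lborel. G z = G' z"
    using completion_ex_borel_measurable_real[of G lborel] G by auto
  have ae': "AE z in lborel. G' z = G z"
    using ae by eventually_elim simp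
  have G'_int: "integrable lborel G'"
    using G integral_completion_AE_cong(1)[of G' lborel G] ae' by simp
  have fub: "integrable lborel (\<lambda>t. LINT s|?P. H (?\<phi> (t, s)))"
    "(LINT t|lborel. LINT s|?P. H (?\<phi> (t, s))) = integral\<^sup>L lborel H"
    if H: "integrable lborel H" for H :: "real^'n \<Rightarrow> real"
  proof -
    have [measurable]: "H \<in> borel_measurable borel"
      using H by auto
    have i: "integrable (lborel \<Otimes>\<^sub>M ?P) (\<lambda>p. H (?\<phi> p))"
      using H by (intro integrable_distr[OF \<phi>]) (simp add: distr)
    show "integrable lborel (\<lambda>t. LINT s|?P. H (?\<phi> (t, s)))"
      by (rule Q.integrable_fst'[OF i])
    have "(LINT t|lborel. LINT s|?P. H (?\<phi> (t, s))) = (LINT p|(lborel \<Otimes>\<^sub>M ?P). H (?\<phi> p))"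
      by (rule Q.integral_fst'[OF i])
    also have "\<dots> = integral\<^sup>L (distr (lborel \<Otimes>\<^sub>M ?P) borel ?\<phi>) H"
      by (rule integral_distr[symmetric, OF \<phi>]) simp
    finally show "(LINT t|lborel. LINT s|?P. H (?\<phi> (t, s))) = integral\<^sup>L lborel H"
      by (simp add: distr)
  qed
  have "AE p in lborel \<Otimes>\<^sub>M ?P. G' (?\<phi> p) = G (?\<phi> p)"
    by (rule AE_distrD[OF \<phi>]) (simp only: distr ae')
  then have "AE t in lborel. AE s in ?P. G' (?\<phi> (t, s)) = G (?\<phi> (t, s))"
    by (rule Q.AE_pair)
  then have proj: "AE t in lborel. (LINT s|?P. G' (?\<phi> (t, s))) = tomographic_projection u U G t"
  proof eventually_elim
    case (elim t)
    have "(\<lambda>s. G' (?\<phi> (t, s))) \<in> borel_measurable ?P"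
      by measurable
    from integral_completion_AE_cong(2)[OF this elim] show ?case
      by (simp add: tomographic_projection_def)
  qed
  have meas: "(\<lambda>t. LINT s|?P. G' (?\<phi> (t, s))) \<in> borel_measurable lborel"
    using fub(1)[OF G'_int] by simp
  show "integrable lebesgue (tomographic_projection u U G)"
    using integral_completion_AE_cong(1)[OF meas proj] fub(1)[OF G'_int] by simp
  have x: "?\<phi> (t, s) \<bullet> u = t" for t s
  proof -
    have "v \<bullet> u = 0" if "v \<in> U" for v
      using basis(2,3) that by (auto simp: pairwise_insert orthogonal_def)
    then show ?thesis
      using u by (simp add: inner_add_left inner_sum_left norm_eq_1)
  qed
  let ?H = "\<lambda>z. indicator {z. z \<bullet> u \<le> x} z *\<^sub>R G' z"
  have H: "integrable lborel ?H"
    by (rule integrable_mult_indicator[OF _ G'_int]) simp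
  have "(LINT t:{..x}|lebesgue. tomographic_projection u U G t) =
      (LINT t|lborel. indicator {..x} t *\<^sub>R (LINT s|?P. G' (?\<phi> (t, s))))"
    unfolding set_lebesgue_integral_def using meas
    by (intro integral_completion_AE_cong(2)) (use proj in \<open>auto elim: eventually_mono\<close>)
  also have "\<dots> = (LINT t|lborel. LINT s|?P. ?H (?\<phi> (t, s)))"
    using x by (intro Bochner_Integration.integral_cong refl) (simp add: indicator_def del: case_prod_conv)
  also have "\<dots> = integral\<^sup>L lborel ?H"
    by (rule fub(2)[OF H])
  also have "\<dots> = (LINT z:{z. z \<bullet> u \<le> x}|lebesgue. G z)"
    unfolding set_lebesgue_integral_def
    by (rule integral_completion_AE_cong(2)[symmetric]) (use ae' in \<open>auto elim: eventually_mono\<close>)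
  finally show "(LINT t:{..x}|lebesgue. tomographic_projection u U G t) = (LINT z:{z. z \<bullet> u \<le> x}|lebesgue. G z)" .
qed

section \<open>Integrals over straddling points\<close>

text \<open>
For fixed \<^term>\<open>z\<close> the points \<^term>\<open>x\<close> that separate \<^term>\<open>\<alpha> z\<close> from \<^term>\<open>\<beta> z\<close> form an interval
of length at most \<^term>\<open>\<epsilon>\<close>, so Tonelli's theorem gives the bound.
\<close>

lemma nn_integral_straddle_le:
  fixes \<alpha> \<beta> :: "'a \<Rightarrow> real" and g :: "'a \<Rightarrow> ennreal"
  assumes "sigma_finite_measure M"
    and [measurable]: "D \<in> sets M" "\<alpha> \<in> borel_measurable M" "\<beta> \<in> borel_measurable M" "g \<in> borel_measurable M"
    and close: "\<And>z. z \<in> D \<Longrightarrow> \<bar>\<alpha> z - \<beta> z\<bar> \<le> \<epsilon>"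
  shows "(\<integral>\<^sup>+x. (\<integral>\<^sup>+z. g z * indicator {z\<in>D. (\<alpha> z \<le> x) \<noteq> (\<beta> z \<le> x)} z \<partial>M) \<partial>lborel) \<le> ennreal \<epsilon> * (\<integral>\<^sup>+z. g z \<partial>M)"
proof -
  interpret M: sigma_finite_measure M by fact
  interpret P: pair_sigma_finite M "lborel :: real measure"
    by standard
  let ?f = "\<lambda>z x. g z * indicator {z\<in>D. (\<alpha> z \<le> x) \<noteq> (\<beta> z \<le> x)} z"
  have meas: "case_prod ?f \<in> borel_measurable (M \<Otimes>\<^sub>M lborel)"
    by (simp add: indicator_def) measurable
  have inner: "(\<integral>\<^sup>+x. ?f z x \<partial>lborel) \<le> g z * ennreal \<epsilon>" for z
  proof -
    have sub: "{x. z \<in> D \<and> (\<alpha> z \<le> x) \<noteq> (\<beta> z \<le> x)} \<subseteq> (if z \<in> D then {min (\<alpha> z) (\<beta> z)..max (\<alpha> z) (\<beta> z)} else {})"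
      by auto
    have "(\<integral>\<^sup>+x. ?f z x \<partial>lborel) = (\<integral>\<^sup>+x. g z * indicator {x. z \<in> D \<and> (\<alpha> z \<le> x) \<noteq> (\<beta> z \<le> x)} x \<partial>lborel)"
      by (simp add: indicator_def)
    also have "\<dots> = g z * emeasure lborel {x. z \<in> D \<and> (\<alpha> z \<le> x) \<noteq> (\<beta> z \<le> x)}"
      by (rule nn_integral_cmult_indicator) measurable
    also have "\<dots> \<le> g z * emeasure lborel (if z \<in> D then {min (\<alpha> z) (\<beta> z)..max (\<alpha> z) (\<beta> z)} else {})"
      by (intro mult_left_mono emeasure_mono[OF sub]) auto
    also have "\<dots> \<le> g z * ennreal \<epsilon>"
      using close[of z] by (intro mult_left_mono) (auto simp: max_def min_def intro!: ennreal_leI)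
    finally show ?thesis .
  qed
  have "(\<integral>\<^sup>+x. (\<integral>\<^sup>+z. ?f z x \<partial>M) \<partial>lborel) = (\<integral>\<^sup>+z. (\<integral>\<^sup>+x. ?f z x \<partial>lborel) \<partial>M)"
    by (rule P.Fubini'[OF meas])
  also have "\<dots> \<le> (\<integral>\<^sup>+z. g z * ennreal \<epsilon> \<partial>M)"
    by (intro nn_integral_mono inner)
  also have "\<dots> = ennreal \<epsilon> * (\<integral>\<^sup>+z. g z \<partial>M)"
    by (simp only: mult.commute[of "ennreal \<epsilon>"]) (rule nn_integral_multc, simp)
  finally show ?thesis .
qed

text \<open>
The graph of the convex function \<^term>\<open>\<lambda>y. y powr p\<close> lies above its tangent at \<^term>\<open>c\<close>; this is
Young's inequality with the conjugate exponents \<^term>\<open>p\<close> and \<^term>\<open>p / (p - 1)\<close>.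
\<close>

lemma powr_tangent:
  fixes y c p :: real
  assumes p: "1 \<le> p" and y: "0 \<le> y" and c: "0 < c"
  shows "p * c powr (p - 1) * y \<le> y powr p + (p - 1) * c powr p"
proof (cases "p = 1")
  case True
  then show ?thesis using y c by (auto simp: powr_one_gt_zero_iff)
next
  case False
  then have p: "1 < p" using p by simp
  have "y * c powr (p - 1) \<le> y powr p / p + (c powr (p - 1)) powr (p / (p - 1)) / (p / (p - 1))"
    using p y by (intro Youngs_inequality) (auto simp: field_simps)
  also have "(c powr (p - 1)) powr (p / (p - 1)) = c powr p"
    using p by (simp add: powr_powr)
  finally have "p * (y * c powr (p - 1)) \<le> p * (y powr p / p + c powr p / (p / (p - 1)))"
    using p by (intro mult_left_mono) auto
  moreover have "p * (y powr p / p + c powr p / (p / (p - 1))) = y powr p + (p - 1) * c powr p"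
    using p by (simp add: distrib_left)
  ultimately show ?thesis
    by (simp add: ac_simps)
qed

text \<open>
This is Hoelder's inequality against the constant function on \<^term>\<open>S\<close>. It follows by integrating the
tangent inequality at the point obtained by dividing the integral of \<^term>\<open>g\<close> over \<^term>\<open>S\<close> by
\<^term>\<open>m\<close>.
\<close>

lemma powr_nn_integral_le:
  fixes g :: "'a \<Rightarrow> real"
  assumes [measurable]: "g \<in> borel_measurable M" "S \<in> sets M" and g: "\<And>z. 0 \<le> g z"
    and m: "0 < m" "emeasure M S \<le> ennreal m" and p: "1 \<le> p"
    and fin: "(\<integral>\<^sup>+z. ennreal (g z) * indicator S z \<partial>M) < \<infinity>"
  shows "ennreal (enn2real (\<integral>\<^sup>+z. ennreal (g z) * indicator S z \<partial>M) powr p)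
    \<le> ennreal (m powr (p - 1)) * (\<integral>\<^sup>+z. ennreal (g z powr p) * indicator S z \<partial>M)"
proof -
  let ?J = "\<integral>\<^sup>+z. ennreal (g z) * indicator S z \<partial>M" and ?I = "\<integral>\<^sup>+z. ennreal (g z powr p) * indicator S z \<partial>M"
  define j where "j = enn2real ?J"
  have J: "?J = ennreal j"
    using fin by (simp add: j_def)
  consider "j = 0" | "?I = \<infinity>" | "j > 0" "?I < \<infinity>"
    using enn2real_nonneg[of ?J] unfolding j_def
    by (metis less_eq_real_def infinity_ennreal_def top.not_eq_extremum)
  then show ?thesis
  proof cases
    case 1
    then show ?thesis by (simp flip: j_def)
  next
    case 2
    then show ?thesis using m by (simp add: ennreal_mult_top)
  next
    case 3
    \<comment> \<open>The mean value of \<^term>\<open>g\<close> over \<^term>\<open>S\<close>, if \<^term>\<open>m\<close> is the measure of \<^term>\<open>S\<close>.\<close>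
    define c where "c = j / m"
    define i where "i = enn2real ?I"
    have I: "?I = ennreal i" "0 \<le> i"
      using 3 by (simp_all add: i_def)
    have c: "0 < c"
      using 3 m by (simp add: c_def)
    have "ennreal (p * c powr (p - 1)) * ?J = (\<integral>\<^sup>+z. ennreal (p * c powr (p - 1) * g z) * indicator S z \<partial>M)"
      using p g by (subst nn_integral_cmult[symmetric]) (auto simp: ennreal_mult' mult.assoc intro!: nn_integral_cong)
    also have "\<dots> \<le> (\<integral>\<^sup>+z. ennreal (g z powr p) * indicator S z + ennreal ((p - 1) * c powr p) * indicator S z \<partial>M)"
    proof (rule nn_integral_mono)
      fix z
      have "ennreal (p * c powr (p - 1) * g z) \<le> ennreal (g z powr p + (p - 1) * c powr p)"
        by (intro ennreal_leI powr_tangent p g c)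
      also have "\<dots> = ennreal (g z powr p) + ennreal ((p - 1) * c powr p)"
        using p by (intro ennreal_plus) auto
      finally have "ennreal (p * c powr (p - 1) * g z) \<le> ennreal (g z powr p) + ennreal ((p - 1) * c powr p)" .
      then show "ennreal (p * c powr (p - 1) * g z) * indicator S z
          \<le> ennreal (g z powr p) * indicator S z + ennreal ((p - 1) * c powr p) * indicator S z"
        by (simp add: indicator_def)
    qed
    also have "\<dots> = ?I + ennreal ((p - 1) * c powr p) * emeasure M S"
      by (subst nn_integral_add) (auto simp: nn_integral_cmult_indicator)
    also have "\<dots> \<le> ennreal i + ennreal ((p - 1) * c powr p) * ennreal m"
      using m by (intro add_mono mult_left_mono) (auto simp: I)
    also have "\<dots> = ennreal (i + (p - 1) * c powr p * m)"
      using p m I by (simp add: ennreal_mult ennreal_plus)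
    finally have "ennreal (p * c powr (p - 1) * j) \<le> ennreal (i + (p - 1) * c powr p * m)"
      using p 3 by (simp add: J ennreal_mult)
    then have "p * c powr (p - 1) * j \<le> i + (p - 1) * c powr p * m"
      using p m I by (subst (asm) ennreal_le_iff) auto
    moreover have "p * c powr (p - 1) * j = p * c powr p * m"
      using c m by (simp add: powr_diff c_def field_simps)
    ultimately have "p * c powr p * m \<le> i + (p - 1) * c powr p * m"
      by linarith
    then have le: "c powr p * m \<le> i"
      by (simp add: algebra_simps)
    have "j powr p = m powr (p - 1) * (c powr p * m)"
      using 3 m by (simp add: c_def powr_divide powr_diff)
    also have "\<dots> \<le> m powr (p - 1) * i"
      by (rule mult_left_mono[OF le]) simp
    finally show ?thesis
      unfolding j_def[symmetric] using I by (auto simp: I(1) ennreal_mult[symmetric] intro!: ennreal_leI)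
  qed
qed

text \<open>
In the orthonormal coordinates a set of diameter at most \<^term>\<open>r\<close> inside the slab lies in a box with
one side of length \<^term>\<open>2 * \<epsilon>\<close> and all others of length \<^term>\<open>r\<close>.
\<close>

lemma emeasure_slab_le:
  fixes u :: "real^'n"
  assumes u: "norm u = 1" and U: "orthonormal_basis_of (orthogonal_comp {u}) U"
    and diam: "\<And>z z'. z \<in> S \<Longrightarrow> z' \<in> S \<Longrightarrow> norm (z - z') \<le> r" and r: "0 < r" and \<epsilon>: "0 < \<epsilon>"
    and slab: "\<And>z. z \<in> S \<Longrightarrow> \<bar>z \<bullet> u - x\<bar> \<le> \<epsilon>"
  shows "emeasure lborel S \<le> ennreal (2 * \<epsilon> * r ^ (CARD('n) - 1))"
proof (cases "S = {}")
  case False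
  then obtain z0 where z0: "z0 \<in> S" by blast
  note basis = orthonormal_basis_of_complement[OF u U]
  define m where "m v = (INF z\<in>S. z \<bullet> v)" for v
  let ?P = "Pi\<^sub>M U (\<lambda>_. lborel :: real measure)"
  let ?\<phi> = "\<lambda>(t, s). t *\<^sub>R u + (\<Sum>v\<in>U. s v *\<^sub>R v)"
  let ?box = "{z. x - \<epsilon> \<le> z \<bullet> u \<and> z \<bullet> u \<le> x + \<epsilon> \<and> (\<forall>v\<in>U. m v \<le> z \<bullet> v \<and> z \<bullet> v \<le> m v + r)}"
  interpret P: product_sigma_finite "\<lambda>_::real^'n. lborel :: real measure"
    by standard
  interpret F: finite_product_sigma_finite "\<lambda>_::real^'n. lborel :: real measure" U
    by standard (rule basis)
  have width: "z \<bullet> v - z' \<bullet> v \<le> r" if "z \<in> S" "z' \<in> S" "v \<in> U" for z z' v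
  proof -
    have "z \<bullet> v - z' \<bullet> v \<le> norm (z - z') * norm v"
      using norm_cauchy_schwarz[of "z - z'" v] by (simp add: inner_diff_left)
    also have "\<dots> \<le> r"
      using diam[of z z'] that basis(4)[of v] by auto
    finally show ?thesis .
  qed
  have m: "m v \<le> z \<bullet> v" "z \<bullet> v \<le> m v + r" if "z \<in> S" "v \<in> U" for z v
  proof -
    have "bdd_below ((\<lambda>z. z \<bullet> v) ` S)"
      using width[OF that(1) _ that(2)] by (intro bdd_belowI2[where m = "z \<bullet> v - r"]) (simp add: algebra_simps)
    then show "m v \<le> z \<bullet> v"
      unfolding m_def using that(1) by (rule cINF_lower)
    have "z \<bullet> v - r \<le> m v"
      unfolding m_def using z0 width[OF that(1) _ that(2)] by (intro cINF_greatest) (auto simp: algebra_simps)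
    then show "z \<bullet> v \<le> m v + r" by simp
  qed
  have "S \<subseteq> ?box"
    using slab m by (force simp: abs_le_iff)
  moreover have box: "?box \<in> sets borel"
    using basis(1) by measurable
  ultimately have "emeasure lborel S \<le> emeasure lborel ?box"
    by (intro emeasure_mono) auto
  also have "\<dots> = emeasure (distr (lborel \<Otimes>\<^sub>M ?P) borel ?\<phi>) ?box"
    by (simp only: distr_orthonormal_coordinates[OF u U])
  also have "\<dots> = emeasure (lborel \<Otimes>\<^sub>M ?P) (?\<phi> -` ?box \<inter> space (lborel \<Otimes>\<^sub>M ?P))"
    by (rule emeasure_distr[OF _ box]) measurable
  also have "?\<phi> -` ?box \<inter> space (lborel \<Otimes>\<^sub>M ?P) = {x - \<epsilon>..x + \<epsilon>} \<times> Pi\<^sub>E U (\<lambda>v. {m v..m v + r})" (is "?L = ?R")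
  proof (rule set_eqI)
    fix q :: "real \<times> (real^'n \<Rightarrow> real)"
    obtain t s where q: "q = (t, s)" by (cases q)
    have orth: "w \<bullet> v = (if w = v then 1 else 0)" if "v \<in> insert u U" "w \<in> insert u U" for v w
      using basis(3) basis(4)[OF that(1)] that by (auto simp: pairwise_def orthogonal_def norm_eq_1)
    have u_coord: "?\<phi> (t, s) \<bullet> u = t"
      using basis(2) by (auto simp: inner_add_left inner_sum_left orth intro!: sum.neutral)
    have v_coord: "?\<phi> (t, s) \<bullet> v = s v" if "v \<in> U" for v
    proof -
      have "(\<Sum>w\<in>U. s w * (w \<bullet> v)) = (\<Sum>w\<in>U. if w = v then s v else 0)"
        using that by (intro sum.cong) (auto simp: orth)
      then show ?thesis
        using that basis(1,2) by (auto simp: inner_add_left inner_sum_left orth)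
    qed
    show "q \<in> ?L \<longleftrightarrow> q \<in> ?R"
      using u_coord v_coord by (auto simp: q space_pair_measure space_PiM PiE_iff)
  qed
  also have "emeasure (lborel \<Otimes>\<^sub>M ?P) \<dots> = ennreal (2 * \<epsilon>) * (\<Prod>v\<in>U. ennreal r)"
    using basis(1) r \<epsilon> by (simp add: F.emeasure_pair_measure_Times P.emeasure_PiM sets_PiM_I_finite)
  also have "\<dots> = ennreal (2 * \<epsilon> * r ^ card U)"
    using r \<epsilon> by (simp add: ennreal_mult ennreal_power)
  also have "card U = CARD('n) - 1"
    using basis(1,2,5) by simp
  finally show ?thesis .
qed simp

lemma Lp_norm_le:
  assumes p: "p \<noteq> \<infinity>" "0 < enn2real p" and c: "0 \<le> c"
    and I: "(\<integral>\<^sup>+x. ennreal (\<bar>f x\<bar> powr enn2real p) \<partial>M) \<le> ennreal (c powr enn2real p)"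
  shows "Lp_norm M p f \<le> ennreal c"
proof -
  let ?I = "\<integral>\<^sup>+x. ennreal (\<bar>f x\<bar> powr enn2real p) \<partial>M"
  have "?I \<noteq> \<infinity>"
    using I by (auto simp: top_unique)
  moreover have "enn2real ?I powr (1 / enn2real p) \<le> c"
  proof -
    have "enn2real ?I \<le> c powr enn2real p"
      using enn2real_mono[OF I] by simp
    then have "enn2real ?I powr (1 / enn2real p) \<le> (c powr enn2real p) powr (1 / enn2real p)"
      using p by (intro powr_mono2) auto
    also have "\<dots> = c"
      using p c by (simp add: powr_powr)
    finally show ?thesis .
  qed
  ultimately show ?thesis
    using p by (simp add: Lp_norm_def Let_def ennreal_leI)
qed

lemma Lp_norm_1: "Lp_norm M 1 f = (\<integral>\<^sup>+x. ennreal \<bar>f x\<bar> \<partial>M)"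
  by (simp add: Lp_norm_def Let_def ennreal_enn2real_if)

text \<open>
The analytic core, stated for an abstract density \<^term>\<open>G\<close> on a set \<^term>\<open>D\<close> so that it applies both
to \<open>F\<close> on \<open>A\<close> and to the deformed density on \<open>B\<close>. The value \<^term>\<open>\<beta> z\<close> stands for the coordinate along
\<^term>\<open>u\<close> of the point that is matched with \<^term>\<open>z\<close>, and \<^term>\<open>W x\<close> is bounded by the mass of \<^term>\<open>G\<close>
on the points whose own coordinate and matched coordinate lie on different sides of \<^term>\<open>x\<close>.

For finite \<^term>\<open>p\<close>, the first bound estimates the \<^term>\<open>p\<close>-th power of this mass by Hoelder's
inequality and the volume of the slab, then integrates over \<^term>\<open>x\<close> by Tonelli's theorem. For the
second bound one factor is split off from the \<^term>\<open>p\<close>-th power and integrated in the same way, while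
the remaining power is bounded by that of the total mass of \<^term>\<open>G\<close>. For \<^term>\<open>p = \<infinity>\<close> the bounds hold pointwise in \<^term>\<open>x\<close>.
\<close>

lemma straddle_Lp_norm_le:
  fixes u :: "real^'n" and G :: "real^'n \<Rightarrow> real" and p :: ennreal
  assumes u: "norm u = 1" and U: "orthonormal_basis_of (orthogonal_comp {u}) U" and p: "1 \<le> p"
    and diam: "\<And>z z'. z \<in> D \<Longrightarrow> z' \<in> D \<Longrightarrow> norm (z - z') \<le> r" and r: "0 < r" and \<epsilon>: "0 < \<epsilon>"
    and [measurable]: "D \<in> sets borel" "\<beta> \<in> borel_measurable borel"
    and close: "\<And>z. z \<in> D \<Longrightarrow> \<bar>z \<bullet> u - \<beta> z\<bar> \<le> \<epsilon>"
    and G: "integrable lebesgue G"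
    and W: "W \<in> borel_measurable (lebesgue_on {a..b})"
    and WG: "\<And>x. x \<in> {a..b} \<Longrightarrow> ennreal \<bar>W x\<bar> \<le>
      (\<integral>\<^sup>+z. ennreal \<bar>G z\<bar> * indicator {z\<in>D. (z \<bullet> u \<le> x) \<noteq> (\<beta> z \<le> x)} z \<partial>lebesgue)"
  shows "Lp_norm (lebesgue_on {a..b}) p W \<le> ennreal \<epsilon> * Lp_norm lebesgue p G *
      ennreal (2 powr conj_exponent p * r powr ((real CARD('n) - 1) * conj_exponent p))" (is ?bound1)
    and "Lp_norm (lebesgue_on {a..b}) p W \<le> ennreal (\<epsilon> powr inv_exponent p) * Lp_norm lebesgue 1 G" (is ?bound2)
proof -
  let ?S = "\<lambda>x. {z\<in>D. (z \<bullet> u \<le> x) \<noteq> (\<beta> z \<le> x)}"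
  let ?q = "real CARD('n) - 1"
  define m where "m = 2 * \<epsilon> * r powr ?q"
  have m: "0 < m"
    using \<epsilon> r by (simp add: m_def)
  have S [measurable]: "?S x \<in> sets borel" for x
    by measurable
  have "r ^ (CARD('n) - 1) = r powr ?q"
    using r by (simp add: powr_realpow[symmetric] of_nat_diff Suc_leI)
  moreover have "emeasure lborel (?S x) \<le> ennreal (2 * \<epsilon> * r ^ (CARD('n) - 1))" for x
  proof (rule emeasure_slab_le[OF u U _ r \<epsilon>])
    show "norm (z - z') \<le> r" if "z \<in> ?S x" "z' \<in> ?S x" for z z'
      using that diam by simp
    show "\<bar>z \<bullet> u - x\<bar> \<le> \<epsilon>" if "z \<in> ?S x" for z
      using that close[of z] by auto
  qed
  ultimately have Sm: "emeasure lborel (?S x) \<le> ennreal m" for x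
    by (simp add: m_def)
  obtain G' where G' [measurable]: "G' \<in> borel_measurable borel" and ae: "AE z in lborel. G z = G' z"
    using completion_ex_borel_measurable_real[of G lborel] G by auto
  define g where "g z = \<bar>G' z\<bar>" for z
  have [measurable]: "g \<in> borel_measurable borel" and g: "\<And>z. 0 \<le> g z"
    unfolding g_def by simp_all
  have ae_g: "AE z in lborel. \<bar>G z\<bar> = g z"
    using ae by eventually_elim (simp add: g_def)
  define J where "J x = (\<integral>\<^sup>+z. ennreal (g z) * indicator (?S x) z \<partial>lborel)" for x
  have WJ: "ennreal \<bar>W x\<bar> \<le> J x" if "x \<in> {a..b}" for x
  proof -
    note WG[OF that]
    also have "(\<integral>\<^sup>+z. ennreal \<bar>G z\<bar> * indicator (?S x) z \<partial>lebesgue) =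
        (\<integral>\<^sup>+z. ennreal \<bar>G z\<bar> * indicator (?S x) z \<partial>lborel)"
      by (rule nn_integral_completion)
    also have "\<dots> = J x"
      unfolding J_def by (rule nn_integral_cong_AE) (use ae_g in \<open>auto elim: eventually_mono\<close>)
    finally show ?thesis .
  qed
  define N where "N = enn2real (\<integral>\<^sup>+z. ennreal (g z) \<partial>lborel)"
  have G1: "Lp_norm lebesgue 1 G = (\<integral>\<^sup>+z. ennreal (g z) \<partial>lborel)"
    unfolding Lp_norm_1 nn_integral_completion
    by (rule nn_integral_cong_AE) (use ae_g in \<open>auto elim: eventually_mono\<close>)
  have "Lp_norm lebesgue 1 G < \<infinity>"
    using G by (simp add: Lp_norm_1 integrable_iff_bounded)
  then have N: "Lp_norm lebesgue 1 G = ennreal N" "0 \<le> N" "(\<integral>\<^sup>+z. ennreal (g z) \<partial>lborel) = ennreal N"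
    by (simp_all add: G1 N_def)
  have JN: "J x \<le> ennreal N" for x
    unfolding J_def N(3)[symmetric] by (rule nn_integral_mono) (simp add: indicator_def)
  have J_fin: "J x < \<infinity>" for x
    using JN[of x] by (simp add: le_less_trans)
  have Fub: "(\<integral>\<^sup>+x. (\<integral>\<^sup>+z. f z * indicator (?S x) z \<partial>lborel) \<partial>lborel) \<le> ennreal \<epsilon> * (\<integral>\<^sup>+z. f z \<partial>lborel)"
    if [measurable]: "f \<in> borel_measurable borel" for f :: "real^'n \<Rightarrow> ennreal"
    by (rule nn_integral_straddle_le) (use close in \<open>auto intro: sigma_finite_lborel\<close>)
  have inner_meas: "(\<lambda>x. \<integral>\<^sup>+z. f z * indicator (?S x) z \<partial>lborel) \<in> borel_measurable lborel"
    if [measurable]: "f \<in> borel_measurable borel" for f :: "real^'n \<Rightarrow> ennreal"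
    by (rule sigma_finite_measure.borel_measurable_nn_integral[OF sigma_finite_lborel])
       (simp add: indicator_def, measurable)
  have "?bound1 \<and> ?bound2"
  proof (cases "p = \<infinity>")
    case True
    have inf: "Lp_norm M p f = esssup M (\<lambda>x. ennreal \<bar>f x\<bar>)" for M and f :: "'x \<Rightarrow> real"
      by (simp add: Lp_norm_def True)
    have le: "Lp_norm (lebesgue_on {a..b}) p W \<le> c" if "\<And>x. x \<in> {a..b} \<Longrightarrow> J x \<le> c" for c
      unfolding inf
    proof (rule esssup_I)
      show "(\<lambda>x. ennreal \<bar>W x\<bar>) \<in> borel_measurable (lebesgue_on {a..b})"
        using W by measurable
      show "AE x in lebesgue_on {a..b}. ennreal \<bar>W x\<bar> \<le> c"
        using order_trans[OF WJ that] by (intro AE_I2) simp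
    qed
    let ?M = "Lp_norm lebesgue p G"
    have "AE z in lebesgue. ennreal \<bar>G z\<bar> \<le> ?M"
      unfolding inf by (rule esssup_AE)
    then have "AE z in lborel. ennreal \<bar>G z\<bar> \<le> ?M"
      by (simp add: AE_completion_iff)
    then have gM: "AE z in lborel. ennreal (g z) \<le> ?M"
      using ae_g by eventually_elim simp
    have "J x \<le> ennreal \<epsilon> * ?M * ennreal (2 * r powr ?q)" for x
    proof -
      have "J x \<le> (\<integral>\<^sup>+z. ?M * indicator (?S x) z \<partial>lborel)"
        unfolding J_def by (rule nn_integral_mono_AE) (use gM in \<open>auto elim!: eventually_mono intro: mult_right_mono\<close>)
      also have "\<dots> = ?M * emeasure lborel (?S x)"
        by (rule nn_integral_cmult_indicator) simp
      also have "\<dots> \<le> ?M * ennreal m"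
        by (rule mult_left_mono[OF Sm]) simp
      also have "\<dots> = ennreal \<epsilon> * ?M * ennreal (2 * r powr ?q)"
        using \<epsilon> r by (simp add: m_def ennreal_mult ac_simps)
      finally show ?thesis .
    qed
    moreover have "conj_exponent p = 1" "inv_exponent p = 0"
      by (simp_all add: True conj_exponent_def inv_exponent_def)
    ultimately show ?thesis
      using le[of "ennreal \<epsilon> * ?M * ennreal (2 * r powr ?q)"] le[of "ennreal N"] JN \<epsilon> by (simp add: N(1))
  next
    case False
    define P where "P = enn2real p"
    have "p = ennreal P"
      using False by (simp add: P_def less_top)
    then have P: "1 \<le> P"
      using p by simp
    have exps: "inv_exponent p = 1 / P" "conj_exponent p = (P - 1) / P"
      using False by (simp_all add: inv_exponent_def conj_exponent_def P_def)
    define j where "j x = enn2real (J x)" for x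
    have j: "J x = ennreal (j x)" "0 \<le> j x" for x
      using J_fin[of x] by (simp_all add: j_def)
    have Wj: "(\<integral>\<^sup>+x. ennreal (\<bar>W x\<bar> powr P) \<partial>lebesgue_on {a..b}) \<le> (\<integral>\<^sup>+x. ennreal (j x powr P) \<partial>lborel)"
    proof -
      have "(\<integral>\<^sup>+x. ennreal (\<bar>W x\<bar> powr P) \<partial>lebesgue_on {a..b}) =
          (\<integral>\<^sup>+x. ennreal (\<bar>W x\<bar> powr P) * indicator {a..b} x \<partial>lebesgue)"
        by (rule nn_integral_restrict_space) simp
      also have "\<dots> = (\<integral>\<^sup>+x. ennreal (\<bar>W x\<bar> powr P) * indicator {a..b} x \<partial>lborel)"
        by (rule nn_integral_completion)
      also have "\<dots> \<le> (\<integral>\<^sup>+x. ennreal (j x powr P) \<partial>lborel)"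
      proof (rule nn_integral_mono)
        fix x
        have "ennreal (\<bar>W x\<bar> powr P) \<le> ennreal (j x powr P)" if "x \<in> {a..b}"
          using WJ[OF that] P j by (intro ennreal_leI powr_mono2) auto
        then show "ennreal (\<bar>W x\<bar> powr P) * indicator {a..b} x \<le> ennreal (j x powr P)"
          by (simp add: indicator_def)
      qed
      finally show ?thesis .
    qed
    have "?bound2"
    proof -
      have "(\<integral>\<^sup>+x. ennreal (j x powr P) \<partial>lborel) \<le> (\<integral>\<^sup>+x. ennreal (N powr (P - 1)) * J x \<partial>lborel)"
      proof (rule nn_integral_mono)
        fix x
        have "j x powr P = j x powr (P - 1) * j x"
          using j[of x] by (cases "j x = 0") (simp_all add: powr_diff)
        also have "\<dots> \<le> N powr (P - 1) * j x"
          using JN[of x] P j N(2) by (intro mult_right_mono powr_mono2) auto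
        finally show "ennreal (j x powr P) \<le> ennreal (N powr (P - 1)) * J x"
          using j by (simp add: j(1) ennreal_mult[symmetric] ennreal_leI)
      qed
      also have "\<dots> = ennreal (N powr (P - 1)) * (\<integral>\<^sup>+x. J x \<partial>lborel)"
        unfolding J_def by (intro nn_integral_cmult inner_meas) measurable
      also have "\<dots> \<le> ennreal (N powr (P - 1)) * (ennreal \<epsilon> * ennreal N)"
        using Fub[of g] unfolding J_def[symmetric] N(3) by (intro mult_left_mono) auto
      also have "\<dots> = ennreal ((\<epsilon> powr (1 / P) * N) powr P)"
      proof -
        have "(\<epsilon> powr (1 / P) * N) powr P = N powr (P - 1) * (\<epsilon> * N)"
          using N(2) \<epsilon> P by (cases "N = 0") (simp_all add: powr_mult powr_powr powr_diff)
        then show ?thesis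
          using N(2) \<epsilon> by (simp add: ennreal_mult)
      qed
      finally have "Lp_norm (lebesgue_on {a..b}) p W \<le> ennreal (\<epsilon> powr (1 / P) * N)"
        using Wj False P N(2) unfolding P_def by (intro Lp_norm_le) auto
      then show ?thesis
        using N(2) by (simp add: exps N(1) ennreal_mult)
    qed
    moreover have "?bound1"
    proof (cases "Lp_norm lebesgue p G = \<infinity>")
      case True
      \<comment> \<open>The constants have to be positive, as \<^term>\<open>0 * \<infinity> = 0\<close> in the extended nonnegative reals.\<close>
      have "0 < 2 powr conj_exponent p * r powr (?q * conj_exponent p)"
        using r by simp
      then show ?thesis
        unfolding True using \<epsilon> r by (simp add: ennreal_mult_top ennreal_top_mult)
    next
      case fin: False
      define k where "k = enn2real (\<integral>\<^sup>+z. ennreal (\<bar>G z\<bar> powr P) \<partial>lebesgue)"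
      have "(\<integral>\<^sup>+z. ennreal (\<bar>G z\<bar> powr P) \<partial>lebesgue) \<noteq> \<infinity>"
        using fin False by (auto simp: Lp_norm_def Let_def P_def split: if_splits)
      then have k: "(\<integral>\<^sup>+z. ennreal (\<bar>G z\<bar> powr P) \<partial>lebesgue) = ennreal k" "0 \<le> k"
        "Lp_norm lebesgue p G = ennreal (k powr (1 / P))"
        using False by (simp_all add: k_def Lp_norm_def Let_def P_def less_top)
      have gk: "(\<integral>\<^sup>+z. ennreal (g z powr P) \<partial>lborel) = ennreal k"
        unfolding k(1)[symmetric] nn_integral_completion
        by (rule nn_integral_cong_AE) (use ae_g in \<open>auto elim: eventually_mono\<close>)
      let ?C = "2 powr conj_exponent p * r powr (?q * conj_exponent p)"
      have "(\<integral>\<^sup>+x. ennreal (j x powr P) \<partial>lborel) \<le>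
          (\<integral>\<^sup>+x. ennreal (m powr (P - 1)) * (\<integral>\<^sup>+z. ennreal (g z powr P) * indicator (?S x) z \<partial>lborel) \<partial>lborel)"
        unfolding j_def J_def
        using J_fin by (intro nn_integral_mono powr_nn_integral_le g m P Sm) (auto simp: J_def)
      also have "\<dots> = ennreal (m powr (P - 1)) *
          (\<integral>\<^sup>+x. (\<integral>\<^sup>+z. ennreal (g z powr P) * indicator (?S x) z \<partial>lborel) \<partial>lborel)"
        by (intro nn_integral_cmult inner_meas) measurable
      also have "\<dots> \<le> ennreal (m powr (P - 1)) * (ennreal \<epsilon> * ennreal k)"
        unfolding gk[symmetric] by (intro mult_left_mono Fub) auto
      also have "\<dots> = ennreal ((\<epsilon> * k powr (1 / P) * ?C) powr P)"
      proof -
        have C: "?C powr P = 2 powr (P - 1) * r powr (?q * (P - 1))"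
          using P by (simp add: powr_mult powr_powr exps)
        have "(\<epsilon> * k powr (1 / P) * ?C) powr P = \<epsilon> powr P * k * ?C powr P"
          using \<epsilon> k(2) P by (simp add: powr_mult powr_powr)
        also have "\<dots> = m powr (P - 1) * (\<epsilon> * k)"
        proof -
          have "m powr (P - 1) = 2 powr (P - 1) * \<epsilon> powr (P - 1) * r powr (?q * (P - 1))"
            using \<epsilon> r by (simp add: m_def powr_mult powr_powr)
          moreover have "\<epsilon> powr P = \<epsilon> powr (P - 1) * \<epsilon>"
            using \<epsilon> by (simp add: powr_diff)
          ultimately show ?thesis
            unfolding C by (simp only: ac_simps)
        qed
        finally show ?thesis
          using k(2) \<epsilon> by (simp add: ennreal_mult)
      qed
      finally have "Lp_norm (lebesgue_on {a..b}) p W \<le> ennreal (\<epsilon> * k powr (1 / P) * ?C)"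
        using Wj False P \<epsilon> unfolding P_def by (intro Lp_norm_le) auto
      then show ?thesis
        using \<epsilon> by (simp add: k(3) ennreal_mult)
    qed
    ultimately show ?thesis by blast
  qed
  then show ?bound1 ?bound2
    by simp_all
qed

lemma set_integral_diff_le:
  fixes f :: "'a \<Rightarrow> real"
  assumes f: "integrable M f" and [measurable]: "S \<in> sets M" "T \<in> sets M"
  shows "ennreal \<bar>(LINT z:S|M. f z) - (LINT z:T|M. f z)\<bar> \<le> (\<integral>\<^sup>+z. ennreal \<bar>f z\<bar> * indicator (sym_diff S T) z \<partial>M)"
proof -
  have i: "integrable M (\<lambda>z. indicator S z *\<^sub>R f z)" "integrable M (\<lambda>z. indicator T z *\<^sub>R f z)"
    by (rule integrable_mult_indicator[OF _ f], simp)+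
  have "(LINT z:S|M. f z) - (LINT z:T|M. f z) = (LINT z|M. indicator S z *\<^sub>R f z - indicator T z *\<^sub>R f z)"
    unfolding set_lebesgue_integral_def using i by simp
  then have "ennreal \<bar>(LINT z:S|M. f z) - (LINT z:T|M. f z)\<bar> \<le>
      (\<integral>\<^sup>+z. ennreal (norm (indicator S z *\<^sub>R f z - indicator T z *\<^sub>R f z)) \<partial>M)"
    using integral_norm_bound_ennreal[OF Bochner_Integration.integrable_diff[OF i]] by simp
  also have "\<dots> = (\<integral>\<^sup>+z. ennreal \<bar>f z\<bar> * indicator (sym_diff S T) z \<partial>M)"
    by (intro nn_integral_cong) (auto simp: indicator_def)
  finally show ?thesis .
qed

text \<open>
The set \<^term>\<open>A\<close> has finite measure. On it \<^term>\<open>\<bar>f x\<bar>\<close> is at most \<^term>\<open>1 + \<bar>f x\<bar> powr enn2real p\<close> if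
\<^term>\<open>p\<close> is finite, and almost everywhere at most the essential supremum otherwise.
\<close>

lemma in_Lp_imp_integrable:
  fixes f :: "'a::euclidean_space \<Rightarrow> real"
  assumes p: "1 \<le> p" and f: "in_Lp lebesgue p f" and A: "bounded A" "open A" and zero: "\<And>x. x \<notin> A \<Longrightarrow> f x = 0"
  shows "integrable lebesgue f"
proof -
  have [measurable]: "f \<in> borel_measurable lebesgue" "A \<in> sets lebesgue"
    using f A by (auto simp: in_Lp_def)
  have Af: "emeasure lebesgue A < \<infinity>"
    using lmeasurable_open[OF A] by (simp add: fmeasurable_def)
  have fin: "Lp_norm lebesgue p f < \<infinity>"
    using f by (simp add: in_Lp_def)
  have "(\<integral>\<^sup>+x. ennreal \<bar>f x\<bar> \<partial>lebesgue) < \<infinity>"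
  proof (cases "p = \<infinity>")
    case True
    let ?M = "Lp_norm lebesgue p f"
    have "AE x in lebesgue. ennreal \<bar>f x\<bar> \<le> ?M"
      by (simp add: Lp_norm_def True esssup_AE)
    then have "AE x in lebesgue. ennreal \<bar>f x\<bar> \<le> ?M * indicator A x"
      by eventually_elim (use zero in \<open>auto simp: indicator_def\<close>)
    then have "(\<integral>\<^sup>+x. ennreal \<bar>f x\<bar> \<partial>lebesgue) \<le> (\<integral>\<^sup>+x. ?M * indicator A x \<partial>lebesgue)"
      by (rule nn_integral_mono_AE)
    also have "\<dots> = ?M * emeasure lebesgue A"
      by (rule nn_integral_cmult_indicator) simp
    also have "\<dots> < \<infinity>"
      using fin Af by (simp add: ennreal_mult_less_top)
    finally show ?thesis .
  next
    case False
    let ?P = "enn2real p"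
    have "p = ennreal ?P"
      using False by (simp add: less_top)
    then have P: "1 \<le> ?P"
      using p by (metis ennreal_ge_1 linorder_not_le)
    have I: "(\<integral>\<^sup>+x. ennreal (\<bar>f x\<bar> powr ?P) \<partial>lebesgue) < \<infinity>"
      using fin False by (auto simp: Lp_norm_def Let_def less_top split: if_splits)
    have "ennreal \<bar>f x\<bar> \<le> indicator A x + ennreal (\<bar>f x\<bar> powr ?P)" for x
    proof (cases "\<bar>f x\<bar> \<le> 1")
      case True
      then have "ennreal \<bar>f x\<bar> \<le> indicator A x"
        using zero[of x] by (auto simp: indicator_def)
      then show ?thesis
        by (simp add: add_increasing2)
    next
      case False
      then have "\<bar>f x\<bar> powr 1 \<le> \<bar>f x\<bar> powr ?P"
        using P by (intro powr_mono) auto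
      then have "ennreal \<bar>f x\<bar> \<le> ennreal (\<bar>f x\<bar> powr ?P)"
        using False by (intro ennreal_leI) simp
      then show ?thesis
        by (simp add: add_increasing)
    qed
    then have "(\<integral>\<^sup>+x. ennreal \<bar>f x\<bar> \<partial>lebesgue) \<le> (\<integral>\<^sup>+x. indicator A x + ennreal (\<bar>f x\<bar> powr ?P) \<partial>lebesgue)"
      by (intro nn_integral_mono)
    also have "\<dots> = emeasure lebesgue A + (\<integral>\<^sup>+x. ennreal (\<bar>f x\<bar> powr ?P) \<partial>lebesgue)"
      by (subst nn_integral_add) auto
    also have "\<dots> < \<infinity>"
      using I Af by simp
    finally show ?thesis .
  qed
  then show ?thesis
    by (simp add: integrable_iff_bounded)
qed

section \<open>The Volterra norm of the difference of projections\<close>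

theorem theorem4p1:
  fixes p :: ennreal
    and A B :: "(real^'n) set"
    and F :: "real^'n \<Rightarrow> real"
    and \<epsilon> r a b :: real
    and \<Phi> :: "real^'n \<Rightarrow> real^'n"
    and u :: "real^'n" and U :: "(real^'n) set"
    and F\<^sub>\<Phi> :: "real^'n \<Rightarrow> real"
    and h :: "real \<Rightarrow> real"
    and K :: ennreal and C :: real
  assumes "1 \<le> p"
    and "A \<noteq> {}" "bounded A" "open A"
    and "B \<noteq> {}" "bounded B" "open B"
    and "r = diameter (A \<union> B)"
    and "in_Lp lebesgue p F" and "\<forall>x. x \<notin> A \<longrightarrow> F x = 0"
    and "\<epsilon> > 0"
    and "eps_deformation \<epsilon> B A \<Phi>"
    and "F\<^sub>\<Phi> = deformed \<Phi> B F"
    and "norm u = 1"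
    and "orthonormal_basis_of (orthogonal_comp {u}) U"
    and "h = (\<lambda>t. tomographic_projection u U F t - tomographic_projection u U F\<^sub>\<Phi> t)"
    and "a \<le> b" and "{t. h t \<noteq> 0} \<subseteq> {a..b}"
    and "K = min (Lp_norm lebesgue p F) (Lp_norm lebesgue p F\<^sub>\<Phi>)"
    and "C = 2 powr conj_exponent p * r powr ((real CARD('n) - 1) * conj_exponent p)"
  shows "volterra_norm a b p h
           \<le> min (ennreal \<epsilon> * K * ennreal C)
                 (ennreal (\<epsilon> powr inv_exponent p) * Lp_norm lebesgue 1 F)"
proof -
  note p = assms(1) and A = assms(2-4) and B = assms(5-7) and F_Lp = assms(9) and \<epsilon> = assms(11)
    and FD = assms(13) and u = assms(14) and U = assms(15) and h_def = assms(16)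
  have zero: "\<And>x. x \<notin> A \<Longrightarrow> F x = 0"
    using assms(10) by blast
  let ?J = "\<lambda>x. jacobian \<Phi> (at x)"
  let ?W = "volterra a h"
  have \<Phi>: "bij_betw \<Phi> B A" "\<And>x. x \<in> B \<Longrightarrow> \<Phi> differentiable (at x)"
    "\<And>x. x \<in> B \<Longrightarrow> norm (x - \<Phi> x) \<le> \<epsilon>"
    using assms(12) by (auto simp: eps_deformation_def)
  have inj: "inj_on \<Phi> B" and img: "\<Phi> ` B = A"
    using \<Phi>(1) by (auto simp: bij_betw_def)
  have cont: "continuous_on B \<Phi>"
    using \<Phi>(2) by (simp add: continuous_at_imp_continuous_on differentiable_imp_continuous_within)
  have der: "(\<Phi> has_derivative (\<lambda>h. ?J x *v h)) (at x)" if "x \<in> B" for x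
    using \<Phi>(2)[OF that] by (simp add: jacobian_works)
  \<comment> \<open>Invariance of domain makes the inverse continuous, hence Borel measurable.\<close>
  obtain \<Psi> where \<Psi>: "homeomorphism B A \<Phi> \<Psi>"
    using invariance_of_domain_homeomorphism[OF B(3) cont _ inj] img by auto
  then have \<Psi>_cont: "continuous_on A \<Psi>" and \<Psi>\<Phi>: "\<And>y. y \<in> B \<Longrightarrow> \<Psi> (\<Phi> y) = y"
    and \<Psi>B: "\<And>z. z \<in> A \<Longrightarrow> \<Psi> z \<in> B" and \<Phi>\<Psi>: "\<And>z. z \<in> A \<Longrightarrow> \<Phi> (\<Psi> z) = z"
    by (auto simp: homeomorphism_def)
  have \<Phi>_in: "\<Phi> y \<in> A" if "y \<in> B" for y
    using img that by blast
  have AB [measurable]: "A \<in> sets borel" "B \<in> sets borel"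
    using A B by simp_all
  have diam: "norm (z - z') \<le> r" if "z \<in> A \<union> B" "z' \<in> A \<union> B" for z z'
    using diameter_bounded_bound[of "A \<union> B" z z'] A(2) B(2) that by (simp add: assms(8) dist_norm)
  have r: "0 < r"
  proof -
    obtain z where z: "z \<in> A" using A(1) by blast
    then have "A \<noteq> {z}"
      using A(3) not_open_singleton[of z] by auto
    then obtain z' where "z' \<in> A" "z' \<noteq> z"
      using z by blast
    then show ?thesis
      using diam[of z z'] z by (simp add: less_le_trans[of 0 "norm (z - z')"])
  qed
  have F: "integrable lebesgue F"
    by (rule in_Lp_imp_integrable[OF p F_Lp A(2,3) zero])
  have cv: "integrable lebesgue (\<lambda>y. indicator T y *\<^sub>R F\<^sub>\<Phi> y)"
    "(LINT y:T|lebesgue. F\<^sub>\<Phi> y) = (LINT z:\<Phi> ` T|lebesgue. F z)"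
    if T: "T \<subseteq> B" "T \<in> sets borel" "\<Phi> ` T \<in> sets borel" for T
  proof -
    have e: "(\<lambda>y. indicator T y *\<^sub>R F\<^sub>\<Phi> y) = (\<lambda>y. indicator T y *\<^sub>R (\<bar>det (?J y)\<bar> * F (\<Phi> y)))"
      using T(1) by (auto simp: FD deformed_def indicator_def fun_eq_iff)
    have FT: "set_integrable lebesgue (\<Phi> ` T) F"
      unfolding set_integrable_def using T(3) by (intro integrable_mult_indicator F) simp
    note * = set_integral_change_of_variables[where J = ?J and g = \<Phi> and f = F and S = T, OF _ der _ FT]
    have T': "T \<in> sets lebesgue" "inj_on \<Phi> T"
      using T inj by (auto intro: inj_on_subset)
    show "integrable lebesgue (\<lambda>y. indicator T y *\<^sub>R F\<^sub>\<Phi> y)"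
      unfolding e using *(1) T' T(1) by (auto simp: set_integrable_def)
    show "(LINT y:T|lebesgue. F\<^sub>\<Phi> y) = (LINT z:\<Phi> ` T|lebesgue. F z)"
      using *(2) T' T(1) unfolding set_lebesgue_integral_def e by auto
  qed
  have FB: "(\<lambda>y. indicator B y *\<^sub>R F\<^sub>\<Phi> y) = F\<^sub>\<Phi>"
    by (auto simp: FD deformed_def indicator_def fun_eq_iff)
  have F\<Phi>: "integrable lebesgue F\<^sub>\<Phi>"
    using cv(1)[of B] img by (simp only: FB) simp
  \<comment> \<open>The matched coordinates: of the point that is moved to \<^term>\<open>z\<close>, and of the point that \<^term>\<open>y\<close> is moved to.\<close>
  define \<alpha> where "\<alpha> z = (if z \<in> A then \<Psi> z \<bullet> u else 0)" for z
  define \<beta> where "\<beta> y = (if y \<in> B then \<Phi> y \<bullet> u else 0)" for y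
  have \<alpha> [measurable]: "\<alpha> \<in> borel_measurable borel" and \<beta> [measurable]: "\<beta> \<in> borel_measurable borel"
    unfolding \<alpha>_def \<beta>_def
    by (intro borel_measurable_continuous_on_if AB continuous_intros \<Psi>_cont cont)+
  have proj_close: "\<bar>v \<bullet> u - w \<bullet> u\<bar> \<le> norm (v - w)" for v w
    using Cauchy_Schwarz_ineq2[of "v - w" u] u by (simp add: inner_diff_left)
  have \<alpha>_close: "\<bar>z \<bullet> u - \<alpha> z\<bar> \<le> \<epsilon>" if "z \<in> A" for z
    using order_trans[OF proj_close \<Phi>(3)[OF \<Psi>B[OF that]]] \<Phi>\<Psi>[OF that] that
    by (simp add: \<alpha>_def abs_minus_commute)
  have \<beta>_close: "\<bar>y \<bullet> u - \<beta> y\<bar> \<le> \<epsilon>" if "y \<in> B" for y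
    using order_trans[OF proj_close \<Phi>(3)[OF that]] that by (simp add: \<beta>_def)
  have h: "integrable lebesgue h"
    unfolding h_def
    by (intro Bochner_Integration.integrable_diff tomographic_projection_Fubini(1)[OF u U] F F\<Phi>)
  have restrict: "(LINT z:T|lebesgue. G z) = (LINT z:T \<inter> D|lebesgue. G z)"
    if "\<And>z. z \<notin> D \<Longrightarrow> G z = 0" for T D and G :: "real^'n \<Rightarrow> real"
    unfolding set_lebesgue_integral_def using that by (intro Bochner_Integration.integral_cong) (auto simp: indicator_def)
  \<comment> \<open>The support condition on \<^term>\<open>h\<close> lets the Volterra integral start at minus infinity.\<close>
  have W: "?W x = (LINT z:{z. z \<bullet> u \<le> x} \<inter> A|lebesgue. F z) - (LINT y:{y. y \<bullet> u \<le> x} \<inter> B|lebesgue. F\<^sub>\<Phi> y)"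
    for x
  proof -
    have out: "h t = 0" if "t < a" for t
      using assms(18) that by auto
    have "?W x = (LINT t:{..x}|lebesgue. h t)"
      unfolding volterra_def set_lebesgue_integral_def
      by (intro Bochner_Integration.integral_cong) (use out in \<open>auto simp: indicator_def not_le\<close>)
    also have "\<dots> = (LINT t:{..x}|lebesgue. tomographic_projection u U F t) -
        (LINT t:{..x}|lebesgue. tomographic_projection u U F\<^sub>\<Phi> t)"
      unfolding h_def
      by (rule set_integral_diff)
         (unfold set_integrable_def, intro integrable_mult_indicator tomographic_projection_Fubini(1)[OF u U] F F\<Phi>; simp)+
    also have "\<dots> = (LINT z:{z. z \<bullet> u \<le> x}|lebesgue. F z) - (LINT y:{y. y \<bullet> u \<le> x}|lebesgue. F\<^sub>\<Phi> y)"
      by (simp only: tomographic_projection_Fubini(2)[OF u U F] tomographic_projection_Fubini(2)[OF u U F\<Phi>])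
    also have "\<dots> = (LINT z:{z. z \<bullet> u \<le> x} \<inter> A|lebesgue. F z) - (LINT y:{y. y \<bullet> u \<le> x} \<inter> B|lebesgue. F\<^sub>\<Phi> y)"
      by (intro arg_cong2[where f = minus] restrict) (simp_all add: zero FD deformed_def)
    finally show ?thesis .
  qed
  \<comment> \<open>Pushing the half-space integral of the deformed density forward to \<^term>\<open>A\<close>.\<close>
  have W_A: "ennreal \<bar>?W x\<bar> \<le>
      (\<integral>\<^sup>+z. ennreal \<bar>F z\<bar> * indicator {z\<in>A. (z \<bullet> u \<le> x) \<noteq> (\<alpha> z \<le> x)} z \<partial>lebesgue)" for x
  proof -
    have im: "\<Phi> ` ({y. y \<bullet> u \<le> x} \<inter> B) = {z\<in>A. \<alpha> z \<le> x}"
    proof (intro equalityI subsetI)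
      fix z assume "z \<in> \<Phi> ` ({y. y \<bullet> u \<le> x} \<inter> B)"
      then obtain y where "y \<in> B" "y \<bullet> u \<le> x" "z = \<Phi> y"
        by blast
      then show "z \<in> {z\<in>A. \<alpha> z \<le> x}"
        using \<Phi>_in by (simp add: \<alpha>_def \<Psi>\<Phi>)
    next
      fix z assume "z \<in> {z\<in>A. \<alpha> z \<le> x}"
      then have "z \<in> A" "\<Psi> z \<bullet> u \<le> x"
        by (auto simp: \<alpha>_def)
      then show "z \<in> \<Phi> ` ({y. y \<bullet> u \<le> x} \<inter> B)"
        using \<Phi>\<Psi> \<Psi>B by (intro image_eqI[where x = "\<Psi> z"]) simp_all
    qed
    have "?W x = (LINT z:{z. z \<bullet> u \<le> x} \<inter> A|lebesgue. F z) - (LINT z:{z\<in>A. \<alpha> z \<le> x}|lebesgue. F z)"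
      unfolding W by (subst cv(2)) (simp_all add: im)
    moreover have "sym_diff ({z. z \<bullet> u \<le> x} \<inter> A) {z\<in>A. \<alpha> z \<le> x} = {z\<in>A. (z \<bullet> u \<le> x) \<noteq> (\<alpha> z \<le> x)}"
      by auto
    ultimately show ?thesis
      using set_integral_diff_le[OF F, of "{z. z \<bullet> u \<le> x} \<inter> A" "{z\<in>A. \<alpha> z \<le> x}"] by simp
  qed
  \<comment> \<open>Pulling the half-space integral of \<^term>\<open>F\<close> back to \<^term>\<open>B\<close>.\<close>
  have W_B: "ennreal \<bar>?W x\<bar> \<le>
      (\<integral>\<^sup>+y. ennreal \<bar>F\<^sub>\<Phi> y\<bar> * indicator {y\<in>B. (y \<bullet> u \<le> x) \<noteq> (\<beta> y \<le> x)} y \<partial>lebesgue)" for x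
  proof -
    have im: "\<Phi> ` {y\<in>B. \<beta> y \<le> x} = {z. z \<bullet> u \<le> x} \<inter> A"
      using img by (auto simp: \<beta>_def)
    have "?W x = (LINT y:{y\<in>B. \<beta> y \<le> x}|lebesgue. F\<^sub>\<Phi> y) - (LINT y:{y. y \<bullet> u \<le> x} \<inter> B|lebesgue. F\<^sub>\<Phi> y)"
      unfolding W by (subst cv(2)[of "{y\<in>B. \<beta> y \<le> x}"]) (simp_all add: im)
    moreover have "sym_diff {y\<in>B. \<beta> y \<le> x} ({y. y \<bullet> u \<le> x} \<inter> B) = {y\<in>B. (y \<bullet> u \<le> x) \<noteq> (\<beta> y \<le> x)}"
      by auto
    ultimately show ?thesis
      using set_integral_diff_le[OF F\<Phi>, of "{y\<in>B. \<beta> y \<le> x}" "{y. y \<bullet> u \<le> x} \<inter> B"] by simp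
  qed
  have W_meas: "?W \<in> borel_measurable (lebesgue_on {a..b})"
  proof -
    have hi: "set_integrable lebesgue S h" if "S \<in> sets lebesgue" for S
      unfolding set_integrable_def by (rule integrable_mult_indicator[OF that h])
    have "?W = (\<lambda>x. integral {a..x} h)"
      unfolding volterra_def by (intro ext set_lebesgue_integral_eq_integral(2) hi) simp
    moreover have "continuous_on {a..b} (\<lambda>x. integral {a..x} h)"
      by (intro indefinite_integral_continuous_1 set_lebesgue_integral_eq_integral(1) hi) simp
    ultimately show ?thesis
      by (simp add: continuous_imp_measurable_on_sets_lebesgue)
  qed
  note bound_A = straddle_Lp_norm_le[OF u U p diam r \<epsilon> AB(1) \<alpha> \<alpha>_close F W_meas W_A]
  note bound_B = straddle_Lp_norm_le[OF u U p diam r \<epsilon> AB(2) \<beta> \<beta>_close F\<Phi> W_meas W_B]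
  have "volterra_norm a b p h \<le> ennreal \<epsilon> * K * ennreal C"
    using bound_A(1) bound_B(1) by (simp add: volterra_norm_def assms(19,20) min_def)
  moreover have "volterra_norm a b p h \<le> ennreal (\<epsilon> powr inv_exponent p) * Lp_norm lebesgue 1 F"
    using bound_A(2) by (simp add: volterra_norm_def)
  ultimately show ?thesis
    by simp
qed

end
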